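(* Let $L$ be a non-characteristically nilpotent filiform Leibniz algebra from the family $F_2(\beta_3,\beta_4,\dots,\beta_n,\gamma)$. If $\gamma\neq 0$ and $n$ is even, then $L$ is isomorphic to one of the following pairwise non-isomorphic algebras: $$F_2^1(0,\dots,0,\beta_{\frac{n+2}{2}},0,\dots,0,0,1),\qquad F_2^2\Big(0,\dots,0,\sqrt{\tfrac{2}{n}},0,\dots,0,1,1\Big).$$ Here $F_2^1(0,\dots,0,\beta_{\frac{n+2}{2}},0,\dots,0,0,1)$ denotes the algebra $F_2(\beta_3,\dots,\beta_n,\gamma)$ with $\gamma=1$, with $\beta_k=0$ for all $k\neq\frac{n+2}{2}$, and with parameter $\beta_{\frac{n+2}{2}}\in\mathbb{C}$; and $F_2^2(0,\dots,0,\sqrt{2/n},0,\dots,0,1,1)$ denotes the algebra $F_2(\beta_3,\dots,\beta_n,\gamma)$ with $\beta_{\frac{n+2}{2}}=\sqrt{2/n}$, $\beta_n=1$, all other $\beta_k=0$, and $\gamma=1$.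
   Context: A Leibniz algebra is a vector space with a bilinear bracket satisfying $[[x,y],z]=[[x,z],y]+[x,[y,z]]$. A derivation of a Leibniz algebra $L$ is a linear map $d:L\to L$ with $d([x,y])=[d(x),y]+[x,d(y)]$. With $L^1=L$, $L^{k+1}=[L^k,L]$, $L$ is nilpotent if $L^m=0$ for some $m$, and an algebra $L$ of dimension $N$ is filiform if $\dim L^i=N-i$ for $2\le i\le N$. A nilpotent Leibniz algebra is characteristically nilpotent if all its derivations are nilpotent linear maps, and non-characteristically nilpotent if it is nilpotent but admits a non-nilpotent derivation. For complex parameters, $F_2(\beta_3,\dots,\beta_n,\gamma)$ denotes the $(n+1)$-dimensional complex filiform Leibniz algebra with basis $\{e_0,e_1,\dots,e_n\}$ and products $[e_0,e_0]=e_2$; $[e_i,e_0]=e_{i+1}$ for $2\le i\le n-1$; $[e_0,e_1]=\sum_{k=3}^n\beta_ke_k$; $[e_1,e_1]=\gamma e_n$; $[e_i,e_1]=\sum_{k=i+2}^n\beta_{k+1-i}e_k$ for $2\le i\le n-2$; all other products of basis elements are zero.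
   Formalization: "Pairwise non-isomorphic" within the family F_2^1 is asserted only for parameters that differ by more than sign: e_1 -> -e_1 is an isomorphism between the algebras F_2^1 with parameters b and -b, so the claim for all distinct parameters is false. *)

theory Defs
  imports Complex_Main "HOL-Library.Function_Algebras"
begin

section \<open>Leibniz algebras over the complex numbers\<close>

text \<open>
  An algebra lives on a linear subspace \<open>alg_carrier L\<close> of an ambient complex vector space
  (the type \<open>'a\<close> with scalar multiplication \<open>alg_scale L\<close>), so that the dimension is not
  tied to a type.  Values of brackets and of linear maps off the carrier are irrelevant.
\<close>

record 'a algebra =
  alg_carrier :: "'a set"
  alg_scale :: "complex \<Rightarrow> 'a \<Rightarrow> 'a"
  alg_bracket :: "'a \<Rightarrow> 'a \<Rightarrow> 'a"

definition leibniz_algebra :: "'a::ab_group_add algebra \<Rightarrow> bool" where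
  "leibniz_algebra L \<longleftrightarrow>
     vector_space (alg_scale L) \<and> module.subspace (alg_scale L) (alg_carrier L) \<and>
     (\<forall>x \<in> alg_carrier L. \<forall>y \<in> alg_carrier L. alg_bracket L x y \<in> alg_carrier L) \<and>
     (\<forall>x \<in> alg_carrier L. \<forall>y \<in> alg_carrier L. \<forall>z \<in> alg_carrier L.
        alg_bracket L (x + y) z = alg_bracket L x z + alg_bracket L y z \<and>
        alg_bracket L x (y + z) = alg_bracket L x y + alg_bracket L x z) \<and>
     (\<forall>c. \<forall>x \<in> alg_carrier L. \<forall>y \<in> alg_carrier L.
        alg_bracket L (alg_scale L c x) y = alg_scale L c (alg_bracket L x y) \<and>
        alg_bracket L x (alg_scale L c y) = alg_scale L c (alg_bracket L x y)) \<and>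
     (\<forall>x \<in> alg_carrier L. \<forall>y \<in> alg_carrier L. \<forall>z \<in> alg_carrier L.
        alg_bracket L (alg_bracket L x y) z =
          alg_bracket L (alg_bracket L x z) y + alg_bracket L x (alg_bracket L y z))"

text \<open>
  \<open>lower_central L k\<close> is $L^k$ for \<open>k \<ge> 1\<close>; the value at \<open>0\<close> is a dummy.
\<close>

fun lower_central :: "'a::ab_group_add algebra \<Rightarrow> nat \<Rightarrow> 'a set" where
  "lower_central L 0 = alg_carrier L"
| "lower_central L (Suc 0) = alg_carrier L"
| "lower_central L (Suc (Suc k)) =
     module.span (alg_scale L)
       {alg_bracket L x y | x y. x \<in> lower_central L (Suc k) \<and> y \<in> alg_carrier L}"

definition nilpotent_algebra :: "'a::ab_group_add algebra \<Rightarrow> bool" where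
  "nilpotent_algebra L \<longleftrightarrow> (\<exists>m\<ge>1. lower_central L m = {0})"

text \<open>
  Finite-dimensionality is explicit because \<open>vector_space.dim\<close> is \<open>0\<close> on
  infinite-dimensional spaces.
\<close>

definition filiform :: "'a::ab_group_add algebra \<Rightarrow> bool" where
  "filiform L \<longleftrightarrow>
     (\<exists>B. finite B \<and> alg_carrier L \<subseteq> module.span (alg_scale L) B) \<and>
     (let N = vector_space.dim (alg_scale L) (alg_carrier L)
      in \<forall>i. 2 \<le> i \<and> i \<le> N \<longrightarrow> vector_space.dim (alg_scale L) (lower_central L i) = N - i)"

definition linear_between ::
    "'a::ab_group_add algebra \<Rightarrow> 'b::ab_group_add algebra \<Rightarrow> ('a \<Rightarrow> 'b) \<Rightarrow> bool" where
  "linear_between L M f \<longleftrightarrow>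
     (\<forall>x \<in> alg_carrier L. f x \<in> alg_carrier M) \<and>
     (\<forall>x \<in> alg_carrier L. \<forall>y \<in> alg_carrier L. f (x + y) = f x + f y) \<and>
     (\<forall>c. \<forall>x \<in> alg_carrier L. f (alg_scale L c x) = alg_scale M c (f x))"

definition derivation :: "'a::ab_group_add algebra \<Rightarrow> ('a \<Rightarrow> 'a) \<Rightarrow> bool" where
  "derivation L d \<longleftrightarrow> linear_between L L d \<and>
     (\<forall>x \<in> alg_carrier L. \<forall>y \<in> alg_carrier L.
        d (alg_bracket L x y) = alg_bracket L (d x) y + alg_bracket L x (d y))"

definition nilpotent_map :: "'a::ab_group_add algebra \<Rightarrow> ('a \<Rightarrow> 'a) \<Rightarrow> bool" where
  "nilpotent_map L d \<longleftrightarrow> (\<exists>m. \<forall>x \<in> alg_carrier L. (d ^^ m) x = 0)"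

definition non_characteristically_nilpotent :: "'a::ab_group_add algebra \<Rightarrow> bool" where
  "non_characteristically_nilpotent L \<longleftrightarrow>
     nilpotent_algebra L \<and> (\<exists>d. derivation L d \<and> \<not> nilpotent_map L d)"

definition isomorphic_algebras ::
    "'a::ab_group_add algebra \<Rightarrow> 'b::ab_group_add algebra \<Rightarrow> bool" where
  "isomorphic_algebras L M \<longleftrightarrow>
     (\<exists>f. linear_between L M f \<and> bij_betw f (alg_carrier L) (alg_carrier M) \<and>
          (\<forall>x \<in> alg_carrier L. \<forall>y \<in> alg_carrier L.
             f (alg_bracket L x y) = alg_bracket M (f x) (f y)))"


section \<open>The family \<open>F\<^sub>2(\<beta>\<^sub>3, \<dots>, \<beta>\<^sub>n, \<gamma>)\<close>\<close>

text \<open>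
  The algebra is realised on the functions \<open>nat \<Rightarrow> complex\<close> vanishing beyond \<open>n\<close>, with
  \<open>basis_vec 0, \<dots>, basis_vec n\<close> as $e_0, \dots, e_n$.  Only the values
  \<open>\<beta> 3, \<dots>, \<beta> n\<close> of \<open>\<beta>\<close> are used.
\<close>

definition fscale :: "complex \<Rightarrow> (nat \<Rightarrow> complex) \<Rightarrow> nat \<Rightarrow> complex" where
  "fscale c x = (\<lambda>i. c * x i)"

definition basis_vec :: "nat \<Rightarrow> nat \<Rightarrow> complex" where
  "basis_vec i = (\<lambda>j. if j = i then 1 else 0)"

definition F2_product ::
    "nat \<Rightarrow> (nat \<Rightarrow> complex) \<Rightarrow> complex \<Rightarrow> nat \<Rightarrow> nat \<Rightarrow> (nat \<Rightarrow> complex)" where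
  "F2_product n \<beta> \<gamma> i j =
    (if i = 0 \<and> j = 0 then basis_vec 2
     else if 2 \<le> i \<and> i \<le> n - 1 \<and> j = 0 then basis_vec (i + 1)
     else if i = 0 \<and> j = 1 then (\<Sum>k = 3..n. fscale (\<beta> k) (basis_vec k))
     else if i = 1 \<and> j = 1 then fscale \<gamma> (basis_vec n)
     else if 2 \<le> i \<and> i \<le> n - 2 \<and> j = 1
       then (\<Sum>k = i + 2..n. fscale (\<beta> (k + 1 - i)) (basis_vec k))
     else 0)"

definition F2 :: "nat \<Rightarrow> (nat \<Rightarrow> complex) \<Rightarrow> complex \<Rightarrow> (nat \<Rightarrow> complex) algebra" where
  "F2 n \<beta> \<gamma> =
    \<lparr> alg_carrier = {x. \<forall>i>n. x i = 0},
      alg_scale = fscale,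
      alg_bracket = (\<lambda>x y. \<Sum>i\<le>n. \<Sum>j\<le>n. fscale (x i * y j) (F2_product n \<beta> \<gamma> i j)) \<rparr>"

definition F2_1 :: "nat \<Rightarrow> complex \<Rightarrow> (nat \<Rightarrow> complex) algebra" where
  "F2_1 n b = F2 n (\<lambda>k. if k = (n + 2) div 2 then b else 0) 1"

definition F2_2 :: "nat \<Rightarrow> (nat \<Rightarrow> complex) algebra" where
  "F2_2 n = F2 n (\<lambda>k. if k = (n + 2) div 2 then complex_of_real (sqrt (2 / real n))
                      else if k = n then 1 else 0) 1"

text \<open>
  The parameter of \<open>F2_1\<close> is an isomorphism invariant at best up to sign:
  $e_1 \mapsto -e_1$ identifies the parameters \<open>b\<close> and \<open>- b\<close>.
\<close>

lemma F2_1_uminus_isomorphic: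
  assumes "3 \<le> n"
  shows "isomorphic_algebras (F2_1 n b) (F2_1 n (- b))"
  unfolding isomorphic_algebras_def
proof (intro exI conjI ballI ext)
  let ?\<beta> = "\<lambda>b k. if k = (n + 2) div 2 then b else (0::complex)"
  let ?f = "\<lambda>(x :: nat \<Rightarrow> complex) i. if i = 1 then - x i else x i"
  show "linear_between (F2_1 n b) (F2_1 n (- b)) ?f"
    by (auto simp: linear_between_def F2_1_def F2_def fscale_def)
  show "bij_betw ?f (alg_carrier (F2_1 n b)) (alg_carrier (F2_1 n (- b)))"
    by (rule bij_betw_byWitness[where f' = ?f]) (auto simp: F2_1_def F2_def)
  have sum_apply: "(\<Sum>i\<in>A. g i) k = (\<Sum>i\<in>A. (g i :: nat \<Rightarrow> complex) k)"
    for g :: "nat \<Rightarrow> nat \<Rightarrow> complex" and A k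
    by (induction A rule: infinite_finite_induct) auto
  have sign: "?f x i * ?f y j * F2_product n (?\<beta> (- b)) 1 i j k
      = ?f (\<lambda>k. x i * y j * F2_product n (?\<beta> b) 1 i j k) k" for x y i j k
  proof -
    have "(\<Sum>m\<in>A. ?\<beta> (- b) (h m) * basis_vec m k) = - (\<Sum>m\<in>A. ?\<beta> b (h m) * basis_vec m k)" for A h
      unfolding sum_negf[symmetric] by (rule sum.cong) auto
    moreover have "(\<Sum>m = l..n. ?\<beta> b (h m) * basis_vec m 1) = 0" if "l > 1" for l h
      by (rule sum.neutral) (use that in \<open>auto simp: basis_vec_def\<close>)
    moreover have "basis_vec m 1 = 0" if "m > 1" for m
      using that by (simp add: basis_vec_def)
    ultimately show ?thesis
      using assms unfolding F2_product_def sum_apply fscale_def by simp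
  qed
  show "?f (alg_bracket (F2_1 n b) x y) k = alg_bracket (F2_1 n (- b)) (?f x) (?f y) k"
    for x y k
    unfolding F2_1_def F2_def algebra.simps sum_apply fscale_def sign
    by (simp add: sum_negf)
qed
end

(*
  Write x in F_2(beta, gamma) as x = P(x) + x_1 e_1, where P(x) = x_0 + x_2 t + x_3 t^2 + ... is a
  truncated polynomial modulo t^n (e_0 = 1 and e_k = t^(k-1) for k >= 2).  With
  b = sum_k beta_k t^(k-1) the bracket becomes
      [x, y] = P(x) (y_0 t + y_1 b) + gamma x_1 y_1 t^(n-1),
  and derivations and isomorphisms are governed by a single congruence modulo t^n.  A derivation
  with d(e_0) = a e_0 + p e_1 + ... and d(e_1) = c e_1 + ... satisfies n a = 2 c and
      (db/dt) (a t + p b) = c b + p gamma t^(n-1);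
  it is nilpotent if a = 0.  An isomorphism with f(e_0) = A e_0 + B e_1 + ... and
  f(e_1) = C e_1 + ... satisfies gamma A^n = C^2 gamma' and
      b(A t + B b') = C b' + (B C gamma' / A) t^(n-1),
  where b' and gamma' belong to the target, and conversely any solution with A = 1 is realised.
  For n = 2m the first congruence with a /= 0 forces b = s t^m + q t^(n-1) with q = 0 or
  gamma /= m s^2.  In either case the second one can be solved with target (s / sqrt gamma) t^m, so
  that an algebra F_2^1 is always reached.  Comparing the coefficients of t^m and t^(n-1) in the
  second congruence separates the algebras in the list: F_2^2 is the exceptional case m s^2 = gamma.
*)

theory Submission
  imports Defs "HOL-Computational_Algebra.Polynomial" "HOL-Number_Theory.Cong"
begin

section \<open>Truncated polynomial model of the bracket\<close>

section \<open>Brackets as multiplication of truncated polynomials\<close>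

text \<open>Degree 0 carries the coordinate of e_0 and degree i > 0 that of e_(i+1). The coordinate
  of e_1 is dropped: e_1 does not fit into the chain of powers of t and is tracked
  separately.\<close>

definition vec_poly :: "nat \<Rightarrow> (nat \<Rightarrow> complex) \<Rightarrow> complex poly" where
  "vec_poly n x = (\<Sum>i<n. monom (x (if i = 0 then 0 else Suc i)) i)"

text \<open>The polynomial of the product [e_0, e_1]; the exponent k - 1 is the degree that belongs
  to e_k.\<close>

definition beta_poly :: "nat \<Rightarrow> (nat \<Rightarrow> complex) \<Rightarrow> complex poly" where
  "beta_poly n \<beta> = (\<Sum>k = 3..n. monom (\<beta> k) (k - 1))"

lemma cong_monom_iff:
  fixes p q :: "'a :: field poly"
  shows "[p = q] (mod monom 1 n) \<longleftrightarrow> (\<forall>i<n. coeff p i = coeff q i)"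
  by (simp add: cong_iff_dvd_diff monom_1_dvd_iff')

lemma coeff_vec_poly:
  "coeff (vec_poly n x) i = (if i < n then x (if i = 0 then 0 else Suc i) else 0)"
  by (simp add: vec_poly_def coeff_sum)

lemma coeff_vec_poly_pred: "2 \<le> k \<Longrightarrow> k \<le> n \<Longrightarrow> coeff (vec_poly n x) (k - 1) = x k"
  by (auto simp: coeff_vec_poly)

lemma coeff_beta_poly:
  "coeff (beta_poly n \<beta>) i = (if 2 \<le> i \<and> i < n then \<beta> (Suc i) else 0)"
proof -
  have "coeff (beta_poly n \<beta>) i = (\<Sum>k = 3..n. if k = Suc i then \<beta> k else 0)"
    unfolding beta_poly_def coeff_sum by (rule sum.cong) auto
  then show ?thesis by (auto simp: sum.delta)
qed

lemma sum_fun_apply: "(\<Sum>i\<in>A. g i) k = (\<Sum>i\<in>A. (g i :: nat \<Rightarrow> complex) k)"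
  by (induction A rule: infinite_finite_induct) auto

lemma vec_poly_add: "vec_poly n (x + y) = vec_poly n x + vec_poly n y"
  by (rule poly_eqI) (simp add: coeff_vec_poly)

lemma vec_poly_fscale: "vec_poly n (fscale c x) = smult c (vec_poly n x)"
  by (rule poly_eqI) (simp add: coeff_vec_poly fscale_def)

lemma vec_poly_0: "vec_poly n 0 = 0"
  by (rule poly_eqI) (simp add: coeff_vec_poly)

lemma vec_poly_sum: "vec_poly n (\<Sum>i\<in>A. g i) = (\<Sum>i\<in>A. vec_poly n (g i))"
proof (induction A rule: infinite_finite_induct)
  case (insert a A)
  then show ?case unfolding sum.insert[OF insert.hyps] vec_poly_add by simp
qed (unfold sum.infinite sum.empty vec_poly_0, simp_all)

lemma vec_poly_basis:
  assumes "i \<le> n" "0 < n"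
  shows "vec_poly n (basis_vec i) = (if i = 0 then 1 else if i = 1 then 0 else monom 1 (i - 1))"
  using assms by (intro poly_eqI) (auto simp: coeff_vec_poly basis_vec_def)

lemma carrier_expand:
  assumes "\<forall>i>n. x i = 0"
  shows "x = (\<Sum>i\<le>n. fscale (x i) (basis_vec i))"
proof
  fix k
  have "(\<Sum>i\<le>n. fscale (x i) (basis_vec i)) k = (\<Sum>i\<le>n. if i = k then x i else 0)"
    unfolding sum_fun_apply by (rule sum.cong) (auto simp: fscale_def basis_vec_def)
  then show "x k = (\<Sum>i\<le>n. fscale (x i) (basis_vec i)) k"
    using assms by (auto simp: sum.delta)
qed

lemma F2_product_0_1:
  assumes "3 \<le> n" "k \<le> 1"
  shows "F2_product n \<beta> \<gamma> i j k = 0"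
  using assms by (auto simp: F2_product_def sum_fun_apply fscale_def basis_vec_def)

lemma F2_product_beyond:
  assumes "3 \<le> n" "n < k"
  shows "F2_product n \<beta> \<gamma> i j k = 0"
  using assms by (auto simp: F2_product_def sum_fun_apply fscale_def basis_vec_def)

lemma beta_poly_dvd: "monom 1 2 dvd beta_poly n \<beta>"
  by (simp add: monom_1_dvd_iff' coeff_beta_poly)

text \<open>Right multiplication by e_0 is the shift e_0, e_2, e_3, ..., e_n, hence multiplication
  by t. It kills e_1, whose polynomial is 0, and it kills e_n because t^n vanishes in the
  congruence.\<close>

lemma F2_product_poly_0:
  assumes "3 \<le> n" "i \<le> n"
  shows "[vec_poly n (F2_product n \<beta> \<gamma> i 0) = vec_poly n (basis_vec i) * monom 1 1] (mod monom 1 n)"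
  using assms unfolding cong_monom_iff mult.commute[of _ "monom _ _"] coeff_monom_mult
  by (auto simp: F2_product_def coeff_vec_poly basis_vec_def)

text \<open>Right multiplication by e_1 is multiplication by b, up to the extra product [e_1, e_1] =
  \<gamma> e_n, which the polynomial of e_1 cannot see. For i = n - 1 and i = n the zero product
  agrees with t^(i-1) b, since b is divisible by t^2.\<close>

lemma F2_product_poly_1:
  assumes "3 \<le> n" "i \<le> n"
  shows "[vec_poly n (F2_product n \<beta> \<gamma> i 1) = vec_poly n (basis_vec i) * beta_poly n \<beta>
    + (if i = 1 then monom \<gamma> (n - 1) else 0)] (mod monom 1 n)"
proof -
  have sum: "(\<Sum>k = l..n. c k * basis_vec k j) = (if l \<le> j \<and> j \<le> n then c j else 0)"
    for l j and c :: "nat \<Rightarrow> complex"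
  proof -
    have "(\<Sum>k = l..n. c k * basis_vec k j) = (\<Sum>k = l..n. if k = j then c k else 0)"
      by (rule sum.cong) (auto simp: basis_vec_def)
    then show ?thesis by auto
  qed
  show ?thesis
    unfolding cong_monom_iff
  proof (intro allI impI)
    fix j assume j: "j < n"
    have e: "vec_poly n (basis_vec i) = (if i = 0 then 1 else if i = 1 then 0 else monom 1 (i - 1))"
      using assms by (intro vec_poly_basis) auto
    consider "i = 0" | "i = 1" | "2 \<le> i" "i \<le> n - 2" | "2 \<le> i" "n - 2 < i" by linarith
    then show "coeff (vec_poly n (F2_product n \<beta> \<gamma> i 1)) j = coeff (vec_poly n (basis_vec i) * beta_poly n \<beta>
      + (if i = 1 then monom \<gamma> (n - 1) else 0)) j"
    proof cases
      case 1
      then show ?thesis using assms j unfolding e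
        by (auto simp: F2_product_def coeff_vec_poly sum_fun_apply fscale_def sum coeff_beta_poly)
    next
      case 2
      then show ?thesis using assms j unfolding e
        by (auto simp: F2_product_def coeff_vec_poly fscale_def basis_vec_def)
    next
      case 3
      then have "F2_product n \<beta> \<gamma> i 1 = (\<Sum>k = i + 2..n. fscale (\<beta> (k + 1 - i)) (basis_vec k))"
        by (simp add: F2_product_def)
      then show ?thesis using 3 assms j unfolding e
        by (auto simp: coeff_vec_poly sum_fun_apply fscale_def sum coeff_monom_mult coeff_beta_poly Suc_diff_le)
    next
      case 4
      then show ?thesis using assms j unfolding e
        by (auto simp: F2_product_def coeff_vec_poly coeff_monom_mult coeff_beta_poly)
    qed
  qed
qed

lemma F2_product_2: "2 \<le> j \<Longrightarrow> F2_product n \<beta> \<gamma> i j = 0"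
  by (auto simp: F2_product_def)

lemma F2_simps:
  "alg_carrier (F2 n \<beta> \<gamma>) = {x. \<forall>i>n. x i = 0}"
  "alg_scale (F2 n \<beta> \<gamma>) = fscale"
  by (simp_all add: F2_def)

lemma bracket_F2:
  assumes "3 \<le> n"
  shows "alg_bracket (F2 n \<beta> \<gamma>) x y =
    (\<Sum>i\<le>n. fscale (x i * y 0) (F2_product n \<beta> \<gamma> i 0) + fscale (x i * y 1) (F2_product n \<beta> \<gamma> i 1))"
proof -
  have "(\<Sum>j\<le>n. fscale (x i * y j) (F2_product n \<beta> \<gamma> i j)) =
      (\<Sum>j\<in>{0,1}. fscale (x i * y j) (F2_product n \<beta> \<gamma> i j))" for i
    by (rule sum.mono_neutral_right)
      (use assms in \<open>auto simp: F2_product_2 fscale_def zero_fun_def not_le\<close>)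
  then show ?thesis by (simp add: F2_def)
qed

lemma bracket_F2_0_1:
  assumes "3 \<le> n" "k \<le> 1"
  shows "alg_bracket (F2 n \<beta> \<gamma>) x y k = 0"
  using assms by (simp add: bracket_F2 sum_fun_apply fscale_def F2_product_0_1)

lemma bracket_F2_carrier:
  assumes "3 \<le> n"
  shows "alg_bracket (F2 n \<beta> \<gamma>) x y \<in> alg_carrier (F2 n \<beta> \<gamma>)"
  using assms by (simp add: F2_simps bracket_F2 sum_fun_apply fscale_def F2_product_beyond)

lemma bracket_F2_basis:
  assumes "3 \<le> n" "i \<le> n" "j \<le> n"
  shows "alg_bracket (F2 n \<beta> \<gamma>) (basis_vec i) (basis_vec j) = F2_product n \<beta> \<gamma> i j"
proof
  fix k
  have "alg_bracket (F2 n \<beta> \<gamma>) (basis_vec i) (basis_vec j) k =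
    (\<Sum>i'\<le>n. \<Sum>j'\<le>n. if j' = j then (if i' = i then F2_product n \<beta> \<gamma> i j k else 0) else 0)"
    unfolding F2_def algebra.simps sum_fun_apply
    by (intro sum.cong refl) (auto simp: fscale_def basis_vec_def)
  then show "alg_bracket (F2 n \<beta> \<gamma>) (basis_vec i) (basis_vec j) k = F2_product n \<beta> \<gamma> i j k"
    using assms by simp
qed

text \<open>Expand x in the basis and add the actions of e_0 and e_1. Together with the vanishing of
  coordinate 1 this determines the bracket, so later arguments need no case distinction on products
  of basis vectors.\<close>

lemma bracket_F2_poly:
  assumes "3 \<le> n" "x \<in> alg_carrier (F2 n \<beta> \<gamma>)"
  shows "[vec_poly n (alg_bracket (F2 n \<beta> \<gamma>) x y) =
    vec_poly n x * (monom (y 0) 1 + smult (y 1) (beta_poly n \<beta>)) + monom (\<gamma> * x 1 * y 1) (n - 1)]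
    (mod monom 1 n)"
proof -
  have x: "vec_poly n x = (\<Sum>i\<le>n. smult (x i) (vec_poly n (basis_vec i)))"
    using arg_cong[OF carrier_expand[of n x], of "vec_poly n"] assms(2)
    by (simp add: F2_simps vec_poly_sum vec_poly_fscale)
  have "[vec_poly n (alg_bracket (F2 n \<beta> \<gamma>) x y) = (\<Sum>i\<le>n.
      smult (x i * y 0) (vec_poly n (basis_vec i) * monom 1 1) +
      smult (x i * y 1) (vec_poly n (basis_vec i) * beta_poly n \<beta>
        + (if i = 1 then monom \<gamma> (n - 1) else 0)))] (mod monom 1 n)"
    unfolding bracket_F2[OF assms(1)] vec_poly_sum vec_poly_add vec_poly_fscale
    using F2_product_poly_0[OF assms(1)] F2_product_poly_1[OF assms(1)]
    by (intro cong_sum cong_add) (simp_all add: cong_monom_iff)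
  also have "(\<Sum>i\<le>n.
      smult (x i * y 0) (vec_poly n (basis_vec i) * monom 1 1) +
      smult (x i * y 1) (vec_poly n (basis_vec i) * beta_poly n \<beta>
        + (if i = 1 then monom \<gamma> (n - 1) else 0))) =
     (\<Sum>i\<le>n. smult (x i) (vec_poly n (basis_vec i)) * (smult (y 0) (monom 1 1))) +
     (\<Sum>i\<le>n. smult (x i) (vec_poly n (basis_vec i)) * smult (y 1) (beta_poly n \<beta>)) +
     (\<Sum>i\<le>n. if i = 1 then smult (x i * y 1) (monom \<gamma> (n - 1)) else 0)"
    unfolding sum.distrib[symmetric]
    by (intro sum.cong refl) (simp add: smult_add_right mult.commute)
  also have "\<dots> = vec_poly n x * (monom (y 0) 1 + smult (y 1) (beta_poly n \<beta>)) + monom (\<gamma> * x 1 * y 1) (n - 1)"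
    unfolding sum_distrib_right[symmetric] x[symmetric]
    using assms(1) by (simp add: smult_monom distrib_left mult_ac)
  finally show ?thesis .
qed

section \<open>Linear maps that are triangular in the basis e_0, ..., e_n\<close>

section \<open>Triangular linear maps\<close>

lemma basis_vec_carrier: "i \<le> n \<Longrightarrow> basis_vec i \<in> alg_carrier (F2 n \<beta> \<gamma>)"
  by (simp add: F2_simps basis_vec_def)

text \<open>\<open>linear_between\<close> speaks about the carrier only, so the summands, and with
  them all partial sums, have to lie there.\<close>

lemma linear_sum:
  assumes f: "linear_between (F2 n \<beta> \<gamma>) (F2 n \<beta>' \<gamma>') f"
    and "\<And>i. i \<in> A \<Longrightarrow> g i \<in> alg_carrier (F2 n \<beta> \<gamma>)"
  shows "f (\<Sum>i\<in>A. fscale (c i) (g i)) = (\<Sum>i\<in>A. fscale (c i) (f (g i)))"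
proof -
  have f0: "f 0 = 0"
  proof -
    have "f (fscale 0 0) = fscale 0 (f 0)"
      using f by (auto simp: linear_between_def F2_simps)
    then show ?thesis by (simp add: fscale_def zero_fun_def)
  qed
  show ?thesis using assms(2)
  proof (induction A rule: infinite_finite_induct)
    case (insert a A)
    have "f (fscale (c a) (g a) + (\<Sum>i\<in>A. fscale (c i) (g i))) =
        f (fscale (c a) (g a)) + f (\<Sum>i\<in>A. fscale (c i) (g i))"
      using insert.prems f
      by (auto simp: linear_between_def F2_simps sum_fun_apply fscale_def)
    moreover have "f (fscale (c a) (g a)) = fscale (c a) (f (g a))"
      using insert.prems f by (simp add: linear_between_def F2_simps)
    moreover have "f (\<Sum>i\<in>A. fscale (c i) (g i)) = (\<Sum>i\<in>A. fscale (c i) (f (g i)))"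
      by (rule insert.IH) (simp add: insert.prems)
    ultimately show ?case
      unfolding sum.insert[OF insert.hyps] by (simp only:)
  qed (unfold sum.infinite sum.empty f0, simp_all)
qed

lemma linear_expand:
  assumes f: "linear_between (F2 n \<beta> \<gamma>) (F2 n \<beta>' \<gamma>') f" and x: "x \<in> alg_carrier (F2 n \<beta> \<gamma>)"
  shows "f x k = (\<Sum>i\<le>n. x i * f (basis_vec i) k)"
proof -
  have "f x = f (\<Sum>i\<le>n. fscale (x i) (basis_vec i))"
    using carrier_expand[of n x] x by (simp add: F2_simps)
  also have "\<dots> = (\<Sum>i\<le>n. fscale (x i) (f (basis_vec i)))"
    using f by (rule linear_sum) (simp add: basis_vec_carrier)
  finally show ?thesis by (simp add: sum_fun_apply fscale_def)
qed

text \<open>In the expansion of f x the basis vectors before e_k have coefficient 0 and the images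
  of those after e_k do not reach coordinate k.\<close>

lemma triangular_coord:
  assumes f: "linear_between (F2 n \<beta> \<gamma>) (F2 n \<beta>' \<gamma>') f" and x: "x \<in> alg_carrier (F2 n \<beta> \<gamma>)"
    and tri: "\<And>i k. i \<le> n \<Longrightarrow> k < i \<Longrightarrow> f (basis_vec i) k = 0"
    and k: "k \<le> n" "\<And>i. i < k \<Longrightarrow> x i = 0"
  shows "f x k = x k * f (basis_vec k) k"
proof -
  have "f x k = (\<Sum>i\<in>{k}. x i * f (basis_vec i) k)"
    unfolding linear_expand[OF f x]
  proof (rule sum.mono_neutral_right)
    show "\<forall>i\<in>{..n} - {k}. x i * f (basis_vec i) k = 0"
    proof
      fix i assume "i \<in> {..n} - {k}"
      then have "i < k \<or> i \<le> n \<and> k < i" by auto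
      then show "x i * f (basis_vec i) k = 0" using tri k(2) by auto
    qed
  qed (use k in auto)
  then show ?thesis by simp
qed

text \<open>Each application of f makes at least one more initial coordinate vanish, so n + 1
  applications give 0.\<close>

lemma triangular_nilpotent:
  assumes f: "linear_between (F2 n \<beta> \<gamma>) (F2 n \<beta> \<gamma>) f"
    and tri: "\<And>i k. i \<le> n \<Longrightarrow> k \<le> i \<Longrightarrow> f (basis_vec i) k = 0"
  shows "nilpotent_map (F2 n \<beta> \<gamma>) f"
proof -
  have *: "(f ^^ m) x \<in> alg_carrier (F2 n \<beta> \<gamma>) \<and> (\<forall>i<m. (f ^^ m) x i = 0)"
    if x: "x \<in> alg_carrier (F2 n \<beta> \<gamma>)" for x m
  proof (induction m)
    case (Suc m)
    let ?y = "(f ^^ m) x"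
    have "f ?y \<in> alg_carrier (F2 n \<beta> \<gamma>)"
      using Suc f by (simp add: linear_between_def)
    moreover have "f ?y i = 0" if "i < Suc m" for i
      unfolding linear_expand[OF f Suc[THEN conjunct1]]
    proof (intro sum.neutral ballI)
      fix j assume "j \<in> {..n}"
      then show "?y j * f (basis_vec j) i = 0"
        using Suc that tri[of j i] by (cases "j < m") auto
    qed
    ultimately show ?case by simp
  qed (use x in simp)
  have "(f ^^ Suc n) x = 0" if "x \<in> alg_carrier (F2 n \<beta> \<gamma>)" for x
  proof
    fix i
    have "\<forall>i>n. (f ^^ Suc n) x i = 0" "\<forall>i<Suc n. (f ^^ Suc n) x i = 0"
      using * [OF that, of "Suc n"] by (simp_all add: F2_simps)
    then show "(f ^^ Suc n) x i = 0 i"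
      by (cases "i < Suc n") auto
  qed
  then show ?thesis unfolding nilpotent_map_def by blast
qed

text \<open>Forward substitution. The first coordinate in which x and y differ is multiplied by a
  nonzero diagonal entry and so distinguishes f x from f y; preimages are built one coordinate at a
  time.\<close>

lemma triangular_bij:
  assumes f: "linear_between (F2 n \<beta> \<gamma>) (F2 n \<beta>' \<gamma>') f"
    and tri: "\<And>i k. i \<le> n \<Longrightarrow> k < i \<Longrightarrow> f (basis_vec i) k = 0"
    and diag: "\<And>i. i \<le> n \<Longrightarrow> f (basis_vec i) i \<noteq> 0"
  shows "bij_betw f (alg_carrier (F2 n \<beta> \<gamma>)) (alg_carrier (F2 n \<beta>' \<gamma>'))"
proof (rule bij_betw_imageI)
  have car: "alg_carrier (F2 n \<beta>' \<gamma>') = alg_carrier (F2 n \<beta> \<gamma>)"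
    by (simp add: F2_simps)
  have add: "f (x + y) = f x + f y" if "x \<in> alg_carrier (F2 n \<beta> \<gamma>)" "y \<in> alg_carrier (F2 n \<beta> \<gamma>)" for x y
    using f that by (simp add: linear_between_def)
  have coord: "f x k = x k * f (basis_vec k) k"
    if "x \<in> alg_carrier (F2 n \<beta> \<gamma>)" "k \<le> n" "\<And>i. i < k \<Longrightarrow> x i = 0" for x k
    using triangular_coord[OF f that(1) tri that(2,3)] by blast
  have coord_add: "f (x + y) k = f x k + y k * f (basis_vec k) k"
    if "x \<in> alg_carrier (F2 n \<beta> \<gamma>)" "y \<in> alg_carrier (F2 n \<beta> \<gamma>)" "k \<le> n" "\<And>i. i < k \<Longrightarrow> y i = 0" for x y k
    using add that coord by simp
  show "inj_on f (alg_carrier (F2 n \<beta> \<gamma>))"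
  proof (rule inj_onI)
    fix x y assume x: "x \<in> alg_carrier (F2 n \<beta> \<gamma>)" and y: "y \<in> alg_carrier (F2 n \<beta> \<gamma>)"
      and eq: "f x = f y"
    have z: "y - x \<in> alg_carrier (F2 n \<beta> \<gamma>)" using x y by (simp add: F2_simps)
    have "(y - x) k = 0" for k
    proof (induction k rule: less_induct)
      case (less k)
      show ?case
      proof (cases "k \<le> n")
        case True
        have "f (x + (y - x)) k = f x k + (y - x) k * f (basis_vec k) k"
          using x z True less by (rule coord_add)
        then show ?thesis using eq diag[OF True] by simp
      qed (use z in \<open>simp add: F2_simps\<close>)
    qed
    then show "x = y" by (auto simp: fun_eq_iff)
  qed
  show "f ` alg_carrier (F2 n \<beta> \<gamma>) = alg_carrier (F2 n \<beta>' \<gamma>')"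
  proof (intro equalityI subsetI)
    fix z assume z: "z \<in> alg_carrier (F2 n \<beta>' \<gamma>')"
    have "\<exists>x\<in>alg_carrier (F2 n \<beta> \<gamma>). \<forall>i<m. f x i = z i" if "m \<le> Suc n" for m
      using that
    proof (induction m)
      case 0
      show ?case using basis_vec_carrier[of 0] by blast
    next
      case (Suc m)
      then obtain x where x: "x \<in> alg_carrier (F2 n \<beta> \<gamma>)" "\<And>i. i < m \<Longrightarrow> f x i = z i"
        by auto
      \<comment> \<open>A multiple of e_m corrects coordinate m of f x to z m and, by triangularity,
        leaves the coordinates below m unchanged.\<close>
      define y where "y = fscale ((z m - f x m) / f (basis_vec m) m) (basis_vec m)"
      have y: "y \<in> alg_carrier (F2 n \<beta> \<gamma>)"
        using Suc.prems by (simp add: y_def F2_simps fscale_def basis_vec_def)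
      have y0: "y i = 0" if "i < m" for i
        using that by (simp add: y_def fscale_def basis_vec_def)
      have "f (x + y) i = z i" if "i < Suc m" for i
      proof (cases "i = m")
        case True
        have "f (x + y) m = f x m + y m * f (basis_vec m) m"
          using Suc.prems y0 by (intro coord_add x y) auto
        moreover have "y m * f (basis_vec m) m = z m - f x m"
          using diag[of m] Suc.prems by (simp add: y_def fscale_def basis_vec_def)
        ultimately show ?thesis using True by simp
      next
        case False
        have "f (x + y) i = f x i + y i * f (basis_vec i) i"
          using Suc.prems y0 that by (intro coord_add x y) auto
        then show ?thesis using x(2) y0 False that by simp
      qed
      moreover have "x + y \<in> alg_carrier (F2 n \<beta> \<gamma>)"
        using x y by (simp add: F2_simps)
      ultimately show ?case by blast
    qed
    from this[OF order_refl] obtain x where x: "x \<in> alg_carrier (F2 n \<beta> \<gamma>)" "\<And>i. i < Suc n \<Longrightarrow> f x i = z i"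
      by auto
    have "f x \<in> alg_carrier (F2 n \<beta>' \<gamma>')" using f x by (simp add: linear_between_def)
    then have "f x i = z i" for i
      using x z by (cases "i < Suc n") (auto simp: F2_simps)
    then have "f x = z" by (rule ext)
    then show "z \<in> f ` alg_carrier (F2 n \<beta> \<gamma>)" using x by blast
  qed (use f in \<open>auto simp: linear_between_def\<close>)
qed

section \<open>Necessary conditions on a derivation\<close>

section \<open>Derivations\<close>

text \<open>The order at 0 is additive: once the lower coefficients of u are known to vanish,
  coefficient i + r of u g is the product of coefficient i of u and coefficient r of g.\<close>

lemma monom_dvd_cancel:
  fixes u g :: "'a :: field poly"
  assumes dvd: "monom 1 (k + r) dvd u * g"
    and g: "\<And>i. i < r \<Longrightarrow> coeff g i = 0" "coeff g r \<noteq> 0"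
  shows "monom 1 k dvd u"
proof -
  have "i < k \<Longrightarrow> coeff u i = 0" for i
  proof (induction i rule: less_induct)
    case (less i)
    have "0 = coeff (u * g) (i + r)"
      using dvd less.prems by (simp add: monom_1_dvd_iff')
    also have "\<dots> = (\<Sum>j\<le>i + r. coeff u j * coeff g (i + r - j))"
      by (simp add: coeff_mult)
    also have "\<dots> = (\<Sum>j\<in>{i}. coeff u j * coeff g (i + r - j))"
    proof (rule sum.mono_neutral_right)
      show "\<forall>j\<in>{..i + r} - {i}. coeff u j * coeff g (i + r - j) = 0"
      proof
        fix j assume j: "j \<in> {..i + r} - {i}"
        show "coeff u j * coeff g (i + r - j) = 0"
        proof (cases "j < i")
          case True
          then show ?thesis using less.IH[of j] less.prems by simp
        next
          case False
          then have "i + r - j < r" using j by auto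
          then show ?thesis using g(1) by simp
        qed
      qed
    qed auto
    finally show ?case using g(2) by simp
  qed
  then show ?thesis by (simp add: monom_1_dvd_iff')
qed

lemma cong_monom_imp_coeff:
  fixes p q :: "'a :: field poly"
  shows "[p = q] (mod monom 1 n) \<Longrightarrow> i < n \<Longrightarrow> coeff p i = coeff q i"
  by (simp add: cong_monom_iff)

lemma smult_mult_monom: "smult c (p * monom 1 k) = p * monom (c :: 'a :: field) k"
  by (simp add: smult_monom mult_smult_right[symmetric] del: mult_smult_right)

lemma mult_beta_poly: "(\<Sum>k = 3..n. smult (\<beta> k) (p * monom 1 (k - 1))) = p * beta_poly n \<beta>"
  unfolding beta_poly_def sum_distrib_left smult_mult_monom ..

lemma pderiv_sum: "pderiv (\<Sum>i\<in>A. f i) = (\<Sum>i\<in>A. pderiv (f i :: complex poly))"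
  by (induction A rule: infinite_finite_induct) (simp_all add: pderiv_add)

lemma mult_pderiv_beta_poly:
  "(\<Sum>k = 3..n. smult (\<beta> k) (smult (of_nat (k - 1)) (monom 1 (k - 2) * p))) = pderiv (beta_poly n \<beta>) * p"
  unfolding beta_poly_def sum_distrib_right pderiv_sum
proof (intro sum.cong refl)
  fix k
  have "smult (\<beta> k) (smult (of_nat (k - 1)) (monom 1 (k - 2))) = pderiv (monom (\<beta> k) (k - 1))"
    by (simp add: pderiv_monom smult_monom diff_diff_eq numeral_2_eq_2)
  then show "smult (\<beta> k) (smult (of_nat (k - 1)) (monom 1 (k - 2) * p)) = pderiv (monom (\<beta> k) (k - 1)) * p"
    by (simp add: mult_smult_left[symmetric] del: mult_smult_left)
qed

text \<open>The Leibniz rule is evaluated on four kinds of products: [e_1, e_0] = 0 bounds d(e_1),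
  the chain of products by e_0 yields d(e_k) for k \<ge> 2, [e_0, e_1] yields the congruence, and
  [e_1, e_1] yields n a = 2 c.\<close>

lemma derivation_F2:
  assumes n: "3 \<le> n" and "\<gamma> \<noteq> 0" and der: "derivation (F2 n \<beta> \<gamma>) d"
  defines "b \<equiv> beta_poly n \<beta>"
  obtains a c p where "of_nat n * a = 2 * c"
    and "[pderiv b * (monom a 1 + smult p b) = smult c b + monom (p * \<gamma>) (n - 1)] (mod monom 1 n)"
    and "a = 0 \<longrightarrow> nilpotent_map (F2 n \<beta> \<gamma>) d"
proof -
  let ?L = "F2 n \<beta> \<gamma>" and ?P = "vec_poly n" and ?X = "monom (1::complex)"
  define e where "e = (basis_vec :: nat \<Rightarrow> nat \<Rightarrow> complex)"
  define a where "a = d (e 0) 0"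
  define p where "p = d (e 0) 1"
  define c where "c = d (e 1) 1"
  define V where "V = ?P (d (e 0))"
  define U where "U = ?P (d (e 1))"
  define G where "G = monom a 1 + smult p b"
  have lin: "linear_between ?L ?L d" using der by (simp add: derivation_def)
  have e: "e i \<in> alg_carrier ?L" if "i \<le> n" for i
    using that by (simp add: e_def basis_vec_carrier)
  have de: "d (e i) \<in> alg_carrier ?L" if "i \<le> n" for i
    using that lin e by (simp add: linear_between_def)
  have e01: "e i 0 = (if i = 0 then 1 else 0)" "e i 1 = (if i = 1 then 1 else 0)" for i
    by (auto simp: e_def basis_vec_def)
  have Pe: "?P (e i) = (if i = 0 then 1 else if i = 1 then 0 else ?X (i - 1))" if "i \<le> n" for i
    using that n by (simp add: e_def vec_poly_basis)
  have dprod: "d (F2_product n \<beta> \<gamma> i j) = alg_bracket ?L (d (e i)) (e j) + alg_bracket ?L (e i) (d (e j))"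
    if "i \<le> n" "j \<le> n" for i j
    using der e that unfolding e_def bracket_F2_basis[OF n that, of \<beta> \<gamma>, symmetric]
    by (simp add: derivation_def)
  have dprod01: "d (F2_product n \<beta> \<gamma> i j) k = 0" if "i \<le> n" "j \<le> n" "k \<le> 1" for i j k
    using that by (simp add: dprod bracket_F2_0_1[OF n])
  have Pprod: "[?P (d (F2_product n \<beta> \<gamma> i j)) =
      (?P (d (e i)) * (monom (e j 0) 1 + smult (e j 1) b) + monom (\<gamma> * d (e i) 1 * e j 1) (n - 1))
    + (?P (e i) * (monom (d (e j) 0) 1 + smult (d (e j) 1) b) + monom (\<gamma> * e i 1 * d (e j) 1) (n - 1))]
    (mod ?X n)" if "i \<le> n" "j \<le> n" for i j
    unfolding dprod[OF that] vec_poly_add b_def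
    by (intro cong_add bracket_F2_poly n e de that)

  have d0: "d 0 = 0" using linear_sum[OF lin, of "{}"] by simp
  \<comment> \<open>This is d applied to [e_1, e_0] = 0. It forces U to vanish below degree n - 2,
    so d(e_1) has no e_0 component.\<close>
  have "[0 = U * ?X 1 + monom (\<gamma> * p) (n - 1)] (mod ?X n)"
  proof -
    have "F2_product n \<beta> \<gamma> 1 0 = 0" by (simp add: F2_product_def)
    then have "d (F2_product n \<beta> \<gamma> 1 0) = 0" using d0 by simp
    then show ?thesis
      using Pprod[of 1 0] n by (simp add: vec_poly_0 e01 Pe U_def p_def del: One_nat_def)
  qed
  then have "?X (n - 1) dvd U * ?X 1"
    unfolding monom_1_dvd_iff'
  proof (intro allI impI)
    fix k assume eq: "[0 = U * ?X 1 + monom (\<gamma> * p) (n - 1)] (mod ?X n)" and k: "k < n - 1"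
    show "coeff (U * ?X 1) k = 0"
      using cong_monom_imp_coeff[OF eq, of k] k by simp
  qed
  then have U: "?X (n - 2) dvd U"
    using n monom_dvd_cancel[of "n - 2" 1 U "?X 1"] by (simp add: Suc_diff_Suc numeral_2_eq_2)
  have de10: "d (e 1) 0 = 0"
  proof -
    have "coeff U 0 = 0" using U n by (simp add: monom_1_dvd_iff')
    then show ?thesis using n by (simp add: U_def coeff_vec_poly)
  qed

  \<comment> \<open>On powers of t the derivation acts as h \<mapsto> V h + (dh/dt) G, where G is
    the polynomial of right multiplication by d(e_0). The induction follows [e_k, e_0] =
    e_(k+1).\<close>
  have PdS: "[?P (d (e k)) = V * ?X (k - 1) + smult (of_nat (k - 1)) (?X (k - 2) * G)] (mod ?X n)"
    if "2 \<le> k" "k \<le> n" for k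
    using that
  proof (induction k rule: dec_induct)
    case base
    have "F2_product n \<beta> \<gamma> 0 0 = e 2" by (simp add: F2_product_def e_def)
    then show ?case
      using Pprod[of 0 0] n by (simp add: e01 Pe V_def G_def a_def p_def monom_0 del: One_nat_def) simp
  next
    case (step k)
    have "F2_product n \<beta> \<gamma> k 0 = e (Suc k)" using step by (simp add: F2_product_def e_def)
    then have "[?P (d (e (Suc k))) = ?P (d (e k)) * ?X 1 + ?X (k - 1) * G] (mod ?X n)"
      using Pprod[of k 0] step by (simp add: e01 Pe G_def a_def p_def del: One_nat_def)
    also have "[?P (d (e k)) * ?X 1 + ?X (k - 1) * G =
       (V * ?X (k - 1) + smult (of_nat (k - 1)) (?X (k - 2) * G)) * ?X 1 + ?X (k - 1) * G] (mod ?X n)"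
      using step by (intro cong_add cong_mult cong_refl) simp
    also have "(V * ?X (k - 1) + smult (of_nat (k - 1)) (?X (k - 2) * G)) * ?X 1 + ?X (k - 1) * G =
       V * ?X (Suc k - 1) + smult (of_nat (Suc k - 1)) (?X (Suc k - 2) * G)"
    proof -
      \<comment> \<open>With k = l + 2 all exponents become successors and the truncated
        subtractions disappear.\<close>
      define l where "l = k - 2"
      then have l: "k = Suc (Suc l)" using step(1) by simp
      have "?X (Suc l) = ?X l * ?X 1" "?X (Suc (Suc l)) = ?X l * ?X 1 * ?X 1"
        by (simp_all add: mult_monom)
      moreover have "(V * (M * Y) + smult r (M * G)) * Y + M * Y * G = V * (M * Y * Y) + smult (1 + r) (M * Y * G)"
        for M Y r by (simp add: smult_add_left algebra_simps)
      ultimately show ?thesis by (simp only: l diff_Suc_1 diff_Suc_Suc minus_nat.diff_0 numeral_2_eq_2 of_nat_Suc One_nat_def)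
    qed
    finally show ?case .
  qed

  have de01: "d (e k) i = 0" if "2 \<le> k" "k \<le> n" "i \<le> 1" for k i
  proof -
    have "e k = F2_product n \<beta> \<gamma> (if k = 2 then 0 else k - 1) 0"
      using that by (auto simp: F2_product_def e_def)
    then show ?thesis using dprod01[of "if k = 2 then 0 else k - 1" 0 i] that by auto
  qed

  \<comment> \<open>Compute d of [e_0, e_1] twice: as the combination of the d(e_k), and by the
    Leibniz rule. The term V b occurs on both sides and cancels.\<close>
  have key: "[pderiv b * G = smult c b + monom (p * \<gamma>) (n - 1)] (mod ?X n)"
  proof -
    have "[V * b + pderiv b * G = (\<Sum>k = 3..n. smult (\<beta> k) (?P (d (e k))))] (mod ?X n)"
    proof -
      have "V * b + pderiv b * G =
        (\<Sum>k = 3..n. smult (\<beta> k) (V * ?X (k - 1) + smult (of_nat (k - 1)) (?X (k - 2) * G)))"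
        by (simp only: smult_add_right sum.distrib b_def mult_beta_poly mult_pderiv_beta_poly)
      also have "[\<dots> = (\<Sum>k = 3..n. smult (\<beta> k) (?P (d (e k))))] (mod ?X n)"
      proof (rule cong_sum)
        fix k assume "k \<in> {3..n}"
        then have "[?P (d (e k)) = V * ?X (k - 1) + smult (of_nat (k - 1)) (?X (k - 2) * G)] (mod ?X n)"
          by (intro PdS) auto
        then show "[smult (\<beta> k) (V * ?X (k - 1) + smult (of_nat (k - 1)) (?X (k - 2) * G)) =
           smult (\<beta> k) (?P (d (e k)))] (mod ?X n)"
          by (simp add: cong_monom_iff del: coeff_add)
      qed
      finally show ?thesis .
    qed
    also have "(\<Sum>k = 3..n. smult (\<beta> k) (?P (d (e k)))) = ?P (d (F2_product n \<beta> \<gamma> 0 1))"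
    proof -
      have "F2_product n \<beta> \<gamma> 0 1 = (\<Sum>k = 3..n. fscale (\<beta> k) (e k))"
        by (simp add: F2_product_def e_def)
      then have "d (F2_product n \<beta> \<gamma> 0 1) = (\<Sum>k = 3..n. fscale (\<beta> k) (d (e k)))"
        using linear_sum[OF lin, of "{3..n}" e \<beta>] e by simp
      then show ?thesis by (simp add: vec_poly_sum vec_poly_fscale)
    qed
    also have "[\<dots> = V * b + (smult c b + monom (p * \<gamma>) (n - 1))] (mod ?X n)"
      using Pprod[of 0 1] n de10
      by (simp add: e01 Pe V_def p_def c_def mult.commute add_ac del: One_nat_def)
    finally show ?thesis by (simp add: cong_add_lcancel)
  qed

  \<comment> \<open>Compare the coefficients of t^(n-1) in d of [e_1, e_1] = \<gamma> e_n. The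
    product U b contributes nothing because its order is at least (n - 2) + 2, and d(e_n)
    contributes a + (n - 1) a.\<close>
  have ac: "of_nat n * a = 2 * c"
  proof -
    have b0: "coeff b 0 = 0" by (simp add: b_def coeff_beta_poly)
    have V0: "coeff V 0 = a" using n by (simp add: V_def a_def coeff_vec_poly)
    have "F2_product n \<beta> \<gamma> 1 1 = fscale \<gamma> (e n)" by (simp add: F2_product_def e_def)
    moreover have "d (fscale \<gamma> (e n)) = fscale \<gamma> (d (e n))"
      using lin e by (simp add: linear_between_def F2_simps)
    ultimately have "[smult \<gamma> (?P (d (e n))) = U * b + monom (\<gamma> * c) (n - 1) + monom (\<gamma> * c) (n - 1)] (mod ?X n)"
      using Pprod[of 1 1] n
      by (simp add: e01 Pe U_def c_def vec_poly_fscale del: One_nat_def)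
    from cong_monom_imp_coeff[OF this, of "n - 1"]
    have "\<gamma> * coeff (?P (d (e n))) (n - 1) = coeff (U * b) (n - 1) + 2 * (\<gamma> * c)"
      using n unfolding coeff_add coeff_smult coeff_monom by simp
    moreover have "coeff (U * b) (n - 1) = 0"
    proof -
      have "?X (n - 2) * ?X 2 dvd U * b"
        unfolding b_def by (intro mult_dvd_mono U beta_poly_dvd)
      then show ?thesis using n by (simp add: mult_monom monom_1_dvd_iff')
    qed
    moreover have "coeff (?P (d (e n))) (n - 1) = of_nat n * a"
    proof -
      have "coeff (?P (d (e n))) (n - 1) =
          coeff (?X (n - 1) * V + smult (of_nat (n - 1)) (?X (n - 2) * G)) (n - 1)"
        using cong_monom_imp_coeff[OF PdS[of n], of "n - 1"] n by (simp add: mult.commute)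
      also have "\<dots> = a + of_nat (n - 1) * a"
        using n V0 by (simp add: coeff_monom_mult G_def b_def coeff_beta_poly)
      also have "\<dots> = of_nat n * a" using n by (simp add: of_nat_diff algebra_simps)
      finally show ?thesis .
    qed
    ultimately show ?thesis using \<open>\<gamma> \<noteq> 0\<close> by simp
  qed

  \<comment> \<open>If a = 0 then also c = 0, and d is strictly triangular: V has no constant term
    and G = p b has order at least 2, so d(e_i) starts beyond coordinate i.\<close>
  have nil: "nilpotent_map ?L d" if "a = 0"
  proof (rule triangular_nilpotent[OF lin])
    fix i k assume ik: "i \<le> n" "k \<le> i"
    have "c = 0" using ac that by simp
    consider "i = 0" | "i = 1" | "2 \<le> i" "k \<le> 1" | "2 \<le> k" using ik by linarith
    then show "d (basis_vec i) k = 0"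
    proof cases
      case 1
      then show ?thesis using \<open>a = 0\<close> ik by (simp add: a_def e_def)
    next
      case 2
      then show ?thesis using \<open>c = 0\<close> de10 ik by (cases "k = 0") (auto simp: c_def e_def le_Suc_eq)
    next
      case 3
      then show ?thesis using de01[of i k] ik by (simp add: e_def)
    next
      case 4
      have V0: "coeff V 0 = 0" using n that by (simp add: V_def a_def coeff_vec_poly)
      have "coeff (?P (d (e i))) (k - 1) =
          coeff (?X (i - 1) * V + smult (of_nat (i - 1)) (?X (i - 2) * G)) (k - 1)"
        using cong_monom_imp_coeff[OF PdS[of i], of "k - 1"] 4 ik by (simp add: mult.commute)
      also have "\<dots> = 0"
        using 4 ik V0 that by (auto simp: coeff_monom_mult G_def b_def coeff_beta_poly)
      finally show ?thesis using 4 ik coeff_vec_poly_pred[of k n "d (e i)"] by (simp add: e_def)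
    qed
  qed
  show thesis using that[OF ac] key nil by (simp add: G_def)
qed

section \<open>Isomorphisms within the family: necessary conditions and a construction\<close>

section \<open>Isomorphisms\<close>

text \<open>Coordinate 1 is the only information that \<open>vec_poly\<close> loses on the carrier.
  Equations between vectors are checked in this way.\<close>

lemma vec_poly_inject:
  assumes "3 \<le> n" "x \<in> alg_carrier (F2 n \<beta> \<gamma>)" "y \<in> alg_carrier (F2 n \<beta> \<gamma>)"
    and "x 1 = y 1" "[vec_poly n x = vec_poly n y] (mod monom 1 n)"
  shows "x = y"
proof
  fix k
  consider "k = 0" | "k = 1" | "2 \<le> k" "k \<le> n" | "n < k" by linarith
  then show "x k = y k"
  proof cases
    case 1
    then show ?thesis using cong_monom_imp_coeff[OF assms(5), of 0] assms(1) by (simp add: coeff_vec_poly)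
  next
    case 3
    then show ?thesis
      using cong_monom_imp_coeff[OF assms(5), of "k - 1"] coeff_vec_poly_pred[of k n x]
        coeff_vec_poly_pred[of k n y] by simp
  qed (use assms in \<open>simp_all add: F2_simps\<close>)
qed

lemma pcompose_monom: "pcompose (monom (c :: 'a :: comm_semiring_1) k) p = smult c (p ^ k)"
proof (induction k)
  case (Suc k)
  then show ?case by (simp add: monom_Suc pcompose_pCons)
qed (simp add: monom_0)

lemma pcompose_beta_poly: "pcompose (beta_poly n \<beta>) p = (\<Sum>k = 3..n. smult (\<beta> k) (p ^ (k - 1)))"
  by (simp add: beta_poly_def pcompose_sum pcompose_monom)

text \<open>Since g has no constant term, substituting it into a multiple of t^n gives a multiple of
  g^n and hence of t^n.\<close>

lemma cong_pcompose:
  fixes p q g :: "'a :: field poly"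
  assumes "[p = q] (mod monom 1 n)" and "monom 1 1 dvd g"
  shows "[pcompose p g = pcompose q g] (mod monom 1 n)"
proof -
  obtain r where r: "p - q = monom 1 n * r" using assms(1) unfolding cong_iff_dvd_diff by (rule dvdE)
  have "pcompose p g - pcompose q g = pcompose (p - q) g" by (simp add: pcompose_diff)
  also have "\<dots> = g ^ n * pcompose r g" by (simp add: r pcompose_mult pcompose_monom)
  finally have "g ^ n dvd pcompose p g - pcompose q g" by simp
  moreover have "monom 1 n dvd g ^ n"
    using dvd_power_same[OF assms(2), of n] by (simp add: monom_power)
  ultimately show ?thesis unfolding cong_iff_dvd_diff by (rule dvd_trans[rotated])
qed

text \<open>Only the leading term of the power matters: each further factor raises the order of the
  error by one, and the new error from w has order at least k + 2.\<close>

lemma cong_monom_power: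
  fixes w :: "'a :: field poly"
  assumes "monom 1 2 dvd w"
  shows "[(monom a 1 + w) ^ k = monom (a ^ k) k] (mod monom 1 (Suc k))"
proof (induction k)
  case 0
  show ?case by (simp add: monom_0 one_pCons)
next
  case (Suc k)
  have "monom 1 1 dvd monom a 1 + w"
    using assms by (simp add: monom_1_dvd_iff')
  then have "monom 1 (Suc k) * monom 1 1 dvd ((monom a 1 + w) ^ k - monom (a ^ k) k) * (monom a 1 + w)"
    using Suc unfolding cong_iff_dvd_diff by (intro mult_dvd_mono)
  moreover have "monom 1 k * monom 1 2 dvd monom (a ^ k) k * w"
    using assms by (intro mult_dvd_mono) (simp_all add: monom_1_dvd_iff')
  moreover have "(monom a 1 + w) ^ Suc k - monom (a ^ Suc k) (Suc k) =
     ((monom a 1 + w) ^ k - monom (a ^ k) k) * (monom a 1 + w) + monom (a ^ k) k * w"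
    by (simp add: algebra_simps mult_monom)
  ultimately show ?case
    unfolding cong_iff_dvd_diff by (simp add: mult_monom)
qed

lemma cong_mult_top_monom:
  fixes p :: "'a :: field poly"
  assumes "0 < n"
  shows "[p * monom r (n - 1) = monom (coeff p 0 * r) (n - 1)] (mod monom 1 n)"
  unfolding cong_monom_iff mult.commute[of p] coeff_monom_mult
proof (intro allI impI)
  fix i assume "i < n"
  then have "i < n - 1 \<or> i = n - 1" by linarith
  then show "(if i < n - 1 then 0 else r * coeff p (i - (n - 1))) = coeff (monom (coeff p 0 * r) (n - 1)) i"
    by auto
qed

text \<open>Only the linear coefficient of p survives. This moves the degree n - 2 correction of the
  isomorphism constructed below into degree n - 1.\<close>

lemma cong_mult_pretop_monom:
  fixes p :: "'a :: field poly"
  assumes "2 \<le> n" "coeff p 0 = 0"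
  shows "[p * monom r (n - 2) = monom (coeff p 1 * r) (n - 1)] (mod monom 1 n)"
  unfolding cong_monom_iff mult.commute[of p] coeff_monom_mult
proof (intro allI impI)
  fix i assume "i < n"
  then have "i < n - 2 \<or> i = n - 2 \<or> i = n - 1 \<and> i - (n - 2) = 1" using assms by linarith
  then show "(if i < n - 2 then 0 else r * coeff p (i - (n - 2))) = coeff (monom (coeff p 1 * r) (n - 1)) i"
    using assms by auto
qed

lemma cong_smult:
  fixes p q :: "'a :: field poly"
  shows "[p = q] (mod m) \<Longrightarrow> [smult c p = smult c q] (mod m)"
  unfolding cong_iff_dvd_diff smult_diff_right[symmetric] by (rule dvd_smult)

text \<open>With G the polynomial of right multiplication by f(e_0), f sends t^(k-1) to V G^(k-1)
  for k \<ge> 3. Hence [e_0, e_1] turns into a congruence for the composition of b with G, and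
  [e_1, e_1] compares \<gamma> with \<gamma>'. Injectivity gives A \<noteq> 0.\<close>

lemma isomorphism_F2:
  assumes n: "3 \<le> n" and "\<gamma> \<noteq> 0" and iso: "isomorphic_algebras (F2 n \<beta> \<gamma>) (F2 n \<beta>' \<gamma>')"
  defines "b \<equiv> beta_poly n \<beta>" and "b' \<equiv> beta_poly n \<beta>'"
  obtains A B C where "A \<noteq> 0" and "\<gamma> * A ^ n = C\<^sup>2 * \<gamma>'"
    and "[pcompose b (monom A 1 + smult B b') = smult C b' + monom (B * C * \<gamma>' / A) (n - 1)] (mod monom 1 n)"
proof -
  let ?L = "F2 n \<beta> \<gamma>" and ?M = "F2 n \<beta>' \<gamma>'" and ?P = "vec_poly n" and ?X = "monom (1::complex)"
  obtain f where lin: "linear_between ?L ?M f" and bij: "bij_betw f (alg_carrier ?L) (alg_carrier ?M)"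
    and hom: "\<And>x y. x \<in> alg_carrier ?L \<Longrightarrow> y \<in> alg_carrier ?L \<Longrightarrow>
      f (alg_bracket ?L x y) = alg_bracket ?M (f x) (f y)"
    using iso unfolding isomorphic_algebras_def by blast
  define e where "e = (basis_vec :: nat \<Rightarrow> nat \<Rightarrow> complex)"
  define A where "A = f (e 0) 0"
  define B where "B = f (e 0) 1"
  define C where "C = f (e 1) 1"
  define V where "V = ?P (f (e 0))"
  define U where "U = ?P (f (e 1))"
  define G where "G = monom A 1 + smult B b'"
  have e: "e i \<in> alg_carrier ?L" if "i \<le> n" for i
    using that by (simp add: e_def basis_vec_carrier)
  have fe: "f (e i) \<in> alg_carrier ?M" if "i \<le> n" for i
    using that lin e by (simp add: linear_between_def)
  have fprod: "f (F2_product n \<beta> \<gamma> i j) = alg_bracket ?M (f (e i)) (f (e j))" if "i \<le> n" "j \<le> n" for i j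
    using hom[OF e e, OF that] bracket_F2_basis[OF n that, of \<beta> \<gamma>] by (simp add: e_def)
  have fprod01: "f (F2_product n \<beta> \<gamma> i j) k = 0" if "i \<le> n" "j \<le> n" "k \<le> 1" for i j k
    using that by (simp add: fprod bracket_F2_0_1[OF n])
  have Pprod: "[?P (f (F2_product n \<beta> \<gamma> i j)) =
      ?P (f (e i)) * (monom (f (e j) 0) 1 + smult (f (e j) 1) b') + monom (\<gamma>' * f (e i) 1 * f (e j) 1) (n - 1)]
    (mod ?X n)" if "i \<le> n" "j \<le> n" for i j
    unfolding fprod[OF that] b'_def by (intro bracket_F2_poly n fe that)
  have b'2: "?X 2 dvd b'" unfolding b'_def by (rule beta_poly_dvd)
  have b'0: "coeff b' 0 = 0" "coeff b' 1 = 0" by (simp_all add: b'_def coeff_beta_poly)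
  have G0: "coeff G 0 = 0" and G1: "coeff G 1 = A" using b'0 by (simp_all add: G_def)

  have f0: "f 0 = 0" using linear_sum[OF lin, of "{}"] by simp
  have P2: "[?P (f (e 2)) = V * G + monom (\<gamma>' * B * B) (n - 1)] (mod ?X n)"
  proof -
    have "F2_product n \<beta> \<gamma> 0 0 = e 2" by (simp add: F2_product_def e_def)
    then show ?thesis using Pprod[of 0 0] by (simp add: V_def G_def A_def B_def)
  qed
  have fe01: "f (e k) i = 0" if "2 \<le> k" "k \<le> n" "i \<le> 1" for k i
  proof -
    have "e k = F2_product n \<beta> \<gamma> (if k = 2 then 0 else k - 1) 0"
      using that by (auto simp: F2_product_def e_def)
    then show ?thesis using fprod01[of "if k = 2 then 0 else k - 1" 0 i] that by auto
  qed
  have PS: "[?P (f (e (Suc k))) = ?P (f (e k)) * G] (mod ?X n)" if "2 \<le> k" "k < n" for k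
  proof -
    have "F2_product n \<beta> \<gamma> k 0 = e (Suc k)" using that by (simp add: F2_product_def e_def)
    then show ?thesis
      using Pprod[of k 0] fe01[of k 1] that by (simp add: G_def A_def B_def)
  qed
  \<comment> \<open>The formula starts at k = 3: f(e_2) has an extra term in t^(n-1) from
    [B e_1, B e_1], which the next factor G removes, as G has no constant term.\<close>
  have P: "[?P (f (e k)) = V * G ^ (k - 1)] (mod ?X n)" if "3 \<le> k" "k \<le> n" for k
    using that
  proof (induction k rule: dec_induct)
    case base
    have "[?P (f (e 3)) = ?P (f (e 2)) * G] (mod ?X n)"
      using PS[of 2] n by (simp add: eval_nat_numeral)
    also have "[?P (f (e 2)) * G = (V * G + monom (\<gamma>' * B * B) (n - 1)) * G] (mod ?X n)"
      by (rule cong_scalar_right[OF P2])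
    also have "(V * G + monom (\<gamma>' * B * B) (n - 1)) * G = V * G ^ 2 + G * monom (\<gamma>' * B * B) (n - 1)"
      by (simp add: algebra_simps power2_eq_square)
    also have "[\<dots> = V * G ^ 2 + monom (coeff G 0 * (\<gamma>' * B * B)) (n - 1)] (mod ?X n)"
      using n by (intro cong_add cong_refl cong_mult_top_monom) simp
    finally show ?case using G0 by simp
  next
    case (step k)
    have "[?P (f (e (Suc k))) = ?P (f (e k)) * G] (mod ?X n)"
      using step by (intro PS) auto
    also have "[?P (f (e k)) * G = V * G ^ (k - 1) * G] (mod ?X n)"
      using step by (intro cong_scalar_right) simp
    also have "V * G ^ (k - 1) * G = V * G ^ (Suc k - 1)"
      using step(1) by (simp add: mult.assoc power_Suc2[symmetric] del: power_Suc)
    finally show ?case .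
  qed

  \<comment> \<open>Otherwise t^2 divides G, so V G^(n-1) vanishes modulo t^n and f(e_n) = 0,
    against injectivity.\<close>
  have "A \<noteq> 0"
  proof
    assume "A = 0"
    have "?X (2 * (n - 1)) dvd G ^ (n - 1)"
    proof -
      have "?X 2 dvd G" using b'2 by (simp add: G_def \<open>A = 0\<close> dvd_smult)
      from dvd_power_same[OF this, of "n - 1"] show ?thesis by (simp add: monom_power)
    qed
    moreover have "?X n dvd ?X (2 * (n - 1))"
      using n by (simp add: monom_1_dvd_iff')
    ultimately have "?X n dvd V * G ^ (n - 1)" by (meson dvd_mult dvd_trans)
    then have "[V * G ^ (n - 1) = 0] (mod ?X n)" by (simp add: cong_0_iff)
    with P[OF n order_refl] have "[?P (f (e n)) = ?P 0] (mod ?X n)"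
      unfolding vec_poly_0 by (rule cong_trans)
    then have "f (e n) = 0"
      using n fe[of n] fe01[of n 1] by (intro vec_poly_inject[OF n]) (auto simp: F2_simps)
    then have "f (e n) = f 0" using f0 by simp
    then have "e n = 0"
      using bij e[of n] unfolding bij_betw_def inj_on_def by (auto simp: F2_simps)
    from fun_cong[OF this, of n] show False by (simp add: e_def basis_vec_def)
  qed

  have "[0 = U * G + monom (\<gamma>' * C * B) (n - 1)] (mod ?X n)"
  proof -
    have "F2_product n \<beta> \<gamma> 1 0 = 0" by (simp add: F2_product_def)
    then have "f (F2_product n \<beta> \<gamma> 1 0) = 0" using f0 by simp
    then show ?thesis
      using Pprod[of 1 0] n by (simp add: vec_poly_0 U_def G_def A_def B_def C_def del: One_nat_def)
  qed
  note U0 = this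
  \<comment> \<open>The image of [e_1, e_0] = 0 shows that U G vanishes below degree n - 1; G has
    order exactly 1 because A \<noteq> 0.\<close>
  have "?X (n - 2 + 1) dvd U * G"
    unfolding monom_1_dvd_iff'
  proof (intro allI impI)
    fix k assume k: "k < n - 2 + 1"
    show "coeff (U * G) k = 0"
    proof -
      have "k < n" "k \<noteq> n - 1" using k n by auto
      then show ?thesis using cong_monom_imp_coeff[OF U0, of k] by simp
    qed
  qed
  then have U: "?X (n - 2) dvd U"
    by (rule monom_dvd_cancel) (use G0 G1 \<open>A \<noteq> 0\<close> in auto)
  have fe10: "f (e 1) 0 = 0"
  proof -
    have "coeff U 0 = 0" using U n by (simp add: monom_1_dvd_iff')
    then show ?thesis using n by (simp add: U_def coeff_vec_poly)
  qed
  have V0: "coeff V 0 = A" using n by (simp add: V_def A_def coeff_vec_poly)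

  \<comment> \<open>Compute f of [e_0, e_1] twice and cancel V, whose constant term is A \<noteq> 0.
    Cancelling it from the top term B C \<gamma>' t^(n-1) produces the denominator A.\<close>
  have key: "[pcompose b G = smult C b' + monom (B * C * \<gamma>' / A) (n - 1)] (mod ?X n)"
  proof -
    let ?r = "B * C * \<gamma>' / A"
    have "V * pcompose b G = (\<Sum>k = 3..n. smult (\<beta> k) (V * G ^ (k - 1)))"
      by (simp add: b_def pcompose_beta_poly sum_distrib_left)
    also have "[\<dots> = (\<Sum>k = 3..n. smult (\<beta> k) (?P (f (e k))))] (mod ?X n)"
      by (intro cong_sum cong_smult cong_sym[OF P]) auto
    also have "(\<Sum>k = 3..n. smult (\<beta> k) (?P (f (e k)))) = ?P (f (F2_product n \<beta> \<gamma> 0 1))"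
    proof -
      have "F2_product n \<beta> \<gamma> 0 1 = (\<Sum>k = 3..n. fscale (\<beta> k) (e k))"
        by (simp add: F2_product_def e_def)
      then have "f (F2_product n \<beta> \<gamma> 0 1) = (\<Sum>k = 3..n. fscale (\<beta> k) (f (e k)))"
        using linear_sum[OF lin, of "{3..n}" e \<beta>] e by simp
      then show ?thesis by (simp add: vec_poly_sum vec_poly_fscale)
    qed
    also have "[\<dots> = V * smult C b' + monom (A * ?r) (n - 1)] (mod ?X n)"
      using Pprod[of 0 1] n fe10 \<open>A \<noteq> 0\<close>
      by (simp add: V_def B_def C_def mult_ac del: One_nat_def)
    also have "[V * smult C b' + monom (A * ?r) (n - 1) = V * smult C b' + V * monom ?r (n - 1)] (mod ?X n)"
      using cong_mult_top_monom[of n V ?r] n V0 by (intro cong_add cong_refl) (simp add: cong_sym_eq)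
    finally have "?X (n + 0) dvd (pcompose b G - (smult C b' + monom ?r (n - 1))) * V"
      unfolding cong_iff_dvd_diff by (simp add: algebra_simps)
    then have "?X n dvd pcompose b G - (smult C b' + monom ?r (n - 1))"
      by (rule monom_dvd_cancel) (use V0 \<open>A \<noteq> 0\<close> in auto)
    then show ?thesis unfolding cong_iff_dvd_diff .
  qed

  \<comment> \<open>Coefficient of t^(n-1) in f of [e_1, e_1] = \<gamma> e_n: the leading term of V
    G^(n-1) is A A^(n-1), and U b' has order at least n.\<close>
  have "\<gamma> * A ^ n = C\<^sup>2 * \<gamma>'"
  proof -
    have "F2_product n \<beta> \<gamma> 1 1 = fscale \<gamma> (e n)" by (simp add: F2_product_def e_def)
    moreover have "f (fscale \<gamma> (e n)) = fscale \<gamma> (f (e n))"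
      using lin e by (simp add: linear_between_def F2_simps)
    ultimately have "[smult \<gamma> (?P (f (e n))) = smult C (U * b') + monom (\<gamma>' * C * C) (n - 1)] (mod ?X n)"
      using Pprod[of 1 1] n fe10
      by (simp add: U_def C_def vec_poly_fscale del: One_nat_def)
    from cong_monom_imp_coeff[OF this, of "n - 1"]
    have "\<gamma> * coeff (?P (f (e n))) (n - 1) = C * coeff (U * b') (n - 1) + \<gamma>' * C * C"
      using n by simp
    moreover have "coeff (U * b') (n - 1) = 0"
    proof -
      have "?X (n - 2) * ?X 2 dvd U * b'" by (intro mult_dvd_mono U b'2)
      then show ?thesis using n by (simp add: mult_monom monom_1_dvd_iff')
    qed
    moreover have "coeff (?P (f (e n))) (n - 1) = A ^ n"
    proof -
      have "[V * G ^ (n - 1) = V * monom (A ^ (n - 1)) (n - 1)] (mod ?X n)"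
        using cong_monom_power[of "smult B b'" A "n - 1"] b'2 n
        by (intro cong_scalar_left) (simp add: G_def dvd_smult)
      also have "[V * monom (A ^ (n - 1)) (n - 1) = monom (A * A ^ (n - 1)) (n - 1)] (mod ?X n)"
        using cong_mult_top_monom[of n V "A ^ (n - 1)"] V0 n by simp
      finally have "[V * G ^ (n - 1) = monom (A * A ^ (n - 1)) (n - 1)] (mod ?X n)" .
      from cong_monom_imp_coeff[OF cong_trans[OF P[OF n order_refl] this], of "n - 1"]
      show ?thesis using n by (simp add: power_Suc[symmetric] del: power_Suc)
    qed
    ultimately show ?thesis by (simp add: power2_eq_square mult_ac)
  qed
  from that[OF \<open>A \<noteq> 0\<close> this key[unfolded G_def]] show thesis .
qed

text \<open>Composition with G respects multiplication of polynomials, and the hypothesis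
  \<open>key\<close> says that it carries b to C b' up to a top term. The map with e_0 \<mapsto> e_0
  + B e_1 and e_1 \<mapsto> C e_1 - C B \<gamma>' e_(n-1) is therefore a homomorphism after
  corrections in the two highest degrees.\<close>

lemma isomorphic_F2_I:
  assumes n: "3 \<le> n" and "C \<noteq> 0" and g: "\<gamma> = C\<^sup>2 * \<gamma>'"
    and key: "[pcompose (beta_poly n \<beta>) (monom 1 1 + smult B (beta_poly n \<beta>')) =
      smult C (beta_poly n \<beta>') + monom (B * C * \<gamma>') (n - 1)] (mod monom 1 n)"
  shows "isomorphic_algebras (F2 n \<beta> \<gamma>) (F2 n \<beta>' \<gamma>')"
proof -
  let ?L = "F2 n \<beta> \<gamma>" and ?M = "F2 n \<beta>' \<gamma>'" and ?P = "vec_poly n" and ?X = "monom (1::complex)"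
  define b where "b = beta_poly n \<beta>"
  define b' where "b' = beta_poly n \<beta>'"
  define G where "G = monom 1 1 + smult B b'"
  define F where "F x = pcompose (?P x) G + monom (x 2 * (B\<^sup>2 * \<gamma>')) (n - 1) - monom (x 1 * (C * B * \<gamma>')) (n - 2)"
    for x :: "nat \<Rightarrow> complex"
  \<comment> \<open>The term in degree \<open>n - 2\<close> makes \<open>[f e\<^sub>1, f e\<^sub>0] = 0\<close>; the one in degree \<open>n - 1\<close> is the
    contribution of \<open>[B e\<^sub>1, B e\<^sub>1]\<close> to \<open>f e\<^sub>2\<close>.\<close>
  define f where "f x = (\<lambda>i. if i = 1 then B * x 0 + C * x 1 else if i \<le> n then coeff (F x) (i - 1) else 0)"
    for x :: "nat \<Rightarrow> complex"
  have b'0: "coeff b' 0 = 0" "coeff b' 1 = 0" by (simp_all add: b'_def coeff_beta_poly)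
  have b'2: "?X 2 dvd b'" unfolding b'_def by (rule beta_poly_dvd)
  have G0: "coeff G 0 = 0" and G1: "coeff G 1 = 1" using b'0 by (simp_all add: G_def)
  have XG: "?X 1 dvd G" using G0 by (simp add: monom_1_dvd_iff')
  have Gpow: "[G ^ k = ?X k] (mod ?X (Suc k))" for k
    using cong_monom_power[of "smult B b'" 1 k] b'2 by (simp add: G_def dvd_smult)
  have Pf: "[?P (f x) = F x] (mod ?X n)" for x
    by (simp add: cong_monom_iff coeff_vec_poly f_def)
  have f_0: "f x 0 = x 0" for x
    using n G0 by (simp add: f_def F_def poly_0_coeff_0 coeff_vec_poly)
  have f_1: "f x 1 = B * x 0 + C * x 1" for x by (simp add: f_def)
  have fc: "f x \<in> alg_carrier ?M" for x using n by (simp add: f_def F2_simps)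

  have lin: "linear_between ?L ?M f"
    unfolding linear_between_def
  proof (intro conjI ballI allI)
    fix x y :: "nat \<Rightarrow> complex"
    have "F (x + y) = F x + F y"
      by (simp add: F_def vec_poly_add pcompose_add add_monom[symmetric] distrib_right)
    then show "f (x + y) = f x + f y"
      by (auto simp: f_def fun_eq_iff algebra_simps)
  next
    fix c and x :: "nat \<Rightarrow> complex"
    have "F (fscale c x) = smult c (F x)"
      unfolding F_def vec_poly_fscale pcompose_smult smult_add_right smult_diff_right smult_monom
      by (simp add: fscale_def mult.assoc)
    then show "f (alg_scale ?L c x) = alg_scale ?M c (f x)"
      by (auto simp: F2_simps f_def fun_eq_iff fscale_def algebra_simps)
  qed (rule fc)

  \<comment> \<open>Coordinate 1 is 0 on both sides. The polynomials of both sides are reduced to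
    \<open>?Q * W + monom r (n - 1)\<close>.\<close>
  have hom: "f (alg_bracket ?L x y) = alg_bracket ?M (f x) (f y)"
    if x: "x \<in> alg_carrier ?L" for x y
  proof (rule vec_poly_inject[OF n fc bracket_F2_carrier[OF n]])
    let ?z = "alg_bracket ?L x y"
    let ?Q = "pcompose (?P x) G"
    have z: "?z 0 = 0" "?z 1 = 0" by (simp_all add: bracket_F2_0_1[OF n])
    then show "f ?z 1 = alg_bracket ?M (f x) (f y) 1"
      using n by (simp add: f_def bracket_F2_0_1)
    have Pz: "[?P ?z = ?P x * (monom (y 0) 1 + smult (y 1) b) + monom (\<gamma> * x 1 * y 1) (n - 1)] (mod ?X n)"
      unfolding b_def by (rule bracket_F2_poly[OF n x])
    \<comment> \<open>The correction in degree n - 1 of \<open>F\<close> depends on coordinate 2, so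
      this coordinate of the bracket is needed explicitly.\<close>
    have z2: "?z 2 = x 0 * y 0"
    proof -
      have "?z 2 = coeff (?P ?z) 1" using coeff_vec_poly_pred[of 2 n ?z] n by simp
      also have "\<dots> = coeff (?P x * (monom (y 0) 1 + smult (y 1) b) + monom (\<gamma> * x 1 * y 1) (n - 1)) 1"
        using cong_monom_imp_coeff[OF Pz, of 1] n by simp
      also have "\<dots> = x 0 * y 0"
        using n by (simp add: coeff_mult b_def coeff_beta_poly coeff_vec_poly)
      finally show ?thesis .
    qed
    have Q0: "coeff ?Q 0 = x 0" using n G0 by (simp add: poly_0_coeff_0 coeff_vec_poly)
    define r where "r = x 0 * y 1 * (B * C * \<gamma>') + \<gamma> * x 1 * y 1 + x 0 * y 0 * (B\<^sup>2 * \<gamma>')"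
    \<comment> \<open>\<open>W\<close> is the polynomial of right multiplication by f y in the
      target algebra.\<close>
    define W where "W = monom (y 0) 1 + smult (B * y 0 + C * y 1) b'"
    have W: "coeff W 0 = 0" "coeff W 1 = y 0" using b'0 by (simp_all add: W_def)
    have QW: "?Q * W = ?Q * (smult (y 0) G + smult (y 1) (smult C b'))"
      by (simp add: W_def G_def smult_add_right smult_add_left smult_monom mult.commute add_ac)

    have "[?P (f ?z) = pcompose (?P ?z) G + monom (x 0 * y 0 * (B\<^sup>2 * \<gamma>')) (n - 1)] (mod ?X n)"
      using Pf[of ?z] z z2 by (simp add: F_def del: One_nat_def)
    also have "[pcompose (?P ?z) G + monom (x 0 * y 0 * (B\<^sup>2 * \<gamma>')) (n - 1) = pcompose (?P x * (monom (y 0) 1 + smult (y 1) b) + monom (\<gamma> * x 1 * y 1) (n - 1)) G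
        + monom (x 0 * y 0 * (B\<^sup>2 * \<gamma>')) (n - 1)] (mod ?X n)"
      by (intro cong_add cong_refl cong_pcompose Pz XG)
    also have "pcompose (?P x * (monom (y 0) 1 + smult (y 1) b) + monom (\<gamma> * x 1 * y 1) (n - 1)) G =
        ?Q * (smult (y 0) G + smult (y 1) (pcompose b G)) + smult (\<gamma> * x 1 * y 1) (G ^ (n - 1))"
      by (simp add: pcompose_add pcompose_mult pcompose_smult pcompose_monom)
    also have "[?Q * (smult (y 0) G + smult (y 1) (pcompose b G)) + smult (\<gamma> * x 1 * y 1) (G ^ (n - 1))
          + monom (x 0 * y 0 * (B\<^sup>2 * \<gamma>')) (n - 1)
        = ?Q * (smult (y 0) G + smult (y 1) (smult C b' + monom (B * C * \<gamma>') (n - 1)))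
          + smult (\<gamma> * x 1 * y 1) (?X (n - 1)) + monom (x 0 * y 0 * (B\<^sup>2 * \<gamma>')) (n - 1)] (mod ?X n)"
      using key Gpow[of "n - 1"] n unfolding b_def[symmetric] b'_def[symmetric] G_def[symmetric]
      by (intro cong_add cong_mult cong_smult cong_refl) simp_all
    also have "?Q * (smult (y 0) G + smult (y 1) (smult C b' + monom (B * C * \<gamma>') (n - 1)))
          + smult (\<gamma> * x 1 * y 1) (?X (n - 1)) + monom (x 0 * y 0 * (B\<^sup>2 * \<gamma>')) (n - 1)
        = ?Q * W + (?Q * monom (y 1 * (B * C * \<gamma>')) (n - 1)
          + monom (\<gamma> * x 1 * y 1 + x 0 * y 0 * (B\<^sup>2 * \<gamma>')) (n - 1))"
      unfolding QW by (simp only: smult_add_right smult_monom distrib_left add_monom[symmetric] mult_1_right add.assoc)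
    also have "[\<dots> = ?Q * W + (monom (coeff ?Q 0 * (y 1 * (B * C * \<gamma>'))) (n - 1)
          + monom (\<gamma> * x 1 * y 1 + x 0 * y 0 * (B\<^sup>2 * \<gamma>')) (n - 1))] (mod ?X n)"
      using n by (intro cong_add cong_refl cong_mult_top_monom) simp
    also have "?Q * W + (monom (coeff ?Q 0 * (y 1 * (B * C * \<gamma>'))) (n - 1)
          + monom (\<gamma> * x 1 * y 1 + x 0 * y 0 * (B\<^sup>2 * \<gamma>')) (n - 1)) = ?Q * W + monom r (n - 1)"
      unfolding Q0 add_monom r_def by (simp add: add_ac mult_ac)
    finally have left: "[?P (f ?z) = ?Q * W + monom r (n - 1)] (mod ?X n)" .

    have "[?P (alg_bracket ?M (f x) (f y)) = ?P (f x) * W + monom (\<gamma>' * f x 1 * f y 1) (n - 1)] (mod ?X n)"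
      using bracket_F2_poly[OF n fc, of x "f y"] by (simp add: W_def b'_def f_0 f_1 del: One_nat_def)
    also have "[?P (f x) * W + monom (\<gamma>' * f x 1 * f y 1) (n - 1) = F x * W + monom (\<gamma>' * f x 1 * f y 1) (n - 1)] (mod ?X n)"
      by (intro cong_add cong_mult cong_refl Pf)
    also have "F x * W + monom (\<gamma>' * f x 1 * f y 1) (n - 1) = ?Q * W +
       (W * monom (x 2 * (B\<^sup>2 * \<gamma>')) (n - 1) - W * monom (x 1 * (C * B * \<gamma>')) (n - 2)
        + monom (\<gamma>' * f x 1 * f y 1) (n - 1))"
      unfolding F_def by (simp add: algebra_simps)
    also have "[\<dots> = ?Q * W +
       (monom (coeff W 0 * (x 2 * (B\<^sup>2 * \<gamma>'))) (n - 1) - monom (coeff W 1 * (x 1 * (C * B * \<gamma>'))) (n - 1)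
        + monom (\<gamma>' * f x 1 * f y 1) (n - 1))] (mod ?X n)"
      using n W by (intro cong_add cong_diff cong_refl cong_mult_top_monom cong_mult_pretop_monom) simp_all
    also have "?Q * W +
       (monom (coeff W 0 * (x 2 * (B\<^sup>2 * \<gamma>'))) (n - 1) - monom (coeff W 1 * (x 1 * (C * B * \<gamma>'))) (n - 1)
        + monom (\<gamma>' * f x 1 * f y 1) (n - 1)) = ?Q * W + monom r (n - 1)"
    proof -
      \<comment> \<open>The mixed term x_1 y_0 of the product of the e_1 coordinates cancels against
        the degree n - 2 correction; \<gamma> = C^2 \<gamma>' matches the term x_1 y_1.\<close>
      have "- (y 0 * (x 1 * (C * B * \<gamma>'))) + \<gamma>' * f x 1 * f y 1 = r"
        unfolding f_1 r_def g by (simp add: algebra_simps power2_eq_square)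
      then show ?thesis
        unfolding W by (simp add: add_monom minus_monom diff_monom)
    qed
    finally have "[?P (alg_bracket ?M (f x) (f y)) = ?Q * W + monom r (n - 1)] (mod ?X n)" .
    then show "[?P (f ?z) = ?P (alg_bracket ?M (f x) (f y))] (mod ?X n)"
      using left by (metis cong_sym cong_trans)
  qed

  \<comment> \<open>G^(i-1) has leading term t^(i-1). The corrections lie strictly beyond the
    diagonal: coordinate n for e_2 and coordinate n - 1 for e_1, where n \<ge> 3.\<close>
  have tri: "f (basis_vec i) k = (if k = i then if i = 1 then C else 1 else 0)" if "i \<le> n" "k \<le> i" for i k
  proof -
    have "k = 0 \<or> k = 1 \<and> i = 1 \<or> k = 1 \<and> 2 \<le> i \<or> 2 \<le> k" using that by arith
    then consider "k = 0" | "k = 1" "i = 1" | "k = 1" "2 \<le> i" | "2 \<le> k" by blast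
    then show ?thesis
    proof cases
      case 1
      then show ?thesis using that by (simp add: f_0 basis_vec_def)
    next
      case 2
      then show ?thesis using f_1 by (simp add: basis_vec_def)
    next
      case 3
      then show ?thesis using f_1 by (simp add: basis_vec_def)
    next
      case 4
      have "f (basis_vec i) k = coeff (F (basis_vec i)) (k - 1)"
        using 4 that by (simp add: f_def)
      also have "\<dots> = coeff (G ^ (i - 1)) (k - 1)"
      proof -
        have "vec_poly n (basis_vec i) = ?X (i - 1)"
          using 4 that n vec_poly_basis[of i n] by simp
        then show ?thesis
          using 4 that n by (auto simp: F_def pcompose_monom basis_vec_def)
      qed
      also have "\<dots> = coeff (?X (i - 1)) (k - 1)"
        using 4 that by (intro cong_monom_imp_coeff[OF Gpow]) simp
      also have "\<dots> = (if k = i then 1 else 0)" using 4 that by auto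
      finally show ?thesis using 4 that by simp
    qed
  qed
  have "bij_betw f (alg_carrier ?L) (alg_carrier ?M)"
    using \<open>C \<noteq> 0\<close> by (intro triangular_bij[OF lin]) (simp_all add: tri)
  with lin hom show ?thesis unfolding isomorphic_algebras_def by blast
qed

section \<open>Solving the two congruences modulo t^(2m)\<close>

section \<open>The case \<open>n = 2 m\<close>\<close>

lemma monom_dvd_pderiv:
  fixes p :: "'a :: field poly"
  assumes "monom 1 (Suc k) dvd p"
  shows "monom 1 k dvd pderiv p"
  using assms by (simp add: monom_1_dvd_iff' coeff_pderiv)

lemma binomial_first_order:
  fixes u w :: "'a :: comm_ring_1"
  shows "w ^ 2 dvd (u + w) ^ Suc k - (u ^ Suc k + of_nat (Suc k) * u ^ k * w)"
proof (induction k)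
  case (Suc k)
  have "(u + w) ^ Suc (Suc k) - (u ^ Suc (Suc k) + of_nat (Suc (Suc k)) * u ^ Suc k * w) =
      (u + w) * ((u + w) ^ Suc k - (u ^ Suc k + of_nat (Suc k) * u ^ k * w)) + w ^ 2 * (of_nat (Suc k) * u ^ k)"
    by (simp add: algebra_simps power2_eq_square)
  then show ?case using Suc by simp
qed simp

text \<open>Coefficient j of the congruence contains a (j - m) b_j, and the remaining terms come
  from p b (db/dt) and p \<gamma> t^(2m-1). The quadratic term has too high an order to matter
  before degree 2m - 1, so b_j = 0 unless j is m or 2m - 1. The top coefficient reads a (m - 1) q =
  p (\<gamma> - m s^2), which excludes q \<noteq> 0 when \<gamma> = m s^2.\<close>

lemma derivation_beta_poly:
  fixes b :: "complex poly" and a p \<gamma> :: complex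
  assumes m: "2 \<le> m" and a: "a \<noteq> 0" and b: "monom 1 2 dvd b" "\<And>j. 2 * m \<le> j \<Longrightarrow> coeff b j = 0"
    and key: "[pderiv b * (monom a 1 + smult p b) = smult (of_nat m * a) b + monom (p * \<gamma>) (2 * m - 1)] (mod monom 1 (2 * m))"
  obtains s q where "b = monom s m + monom q (2 * m - 1)" and "q = 0 \<or> \<gamma> \<noteq> of_nat m * s\<^sup>2"
proof -
  have coeff: "a * (of_nat j - of_nat m) * coeff b j =
      (if j = 2 * m - 1 then p * \<gamma> else 0) - p * coeff (pderiv b * b) j" if "j < 2 * m" for j
  proof -
    have "pderiv b * (monom a 1 + smult p b) = monom a 1 * pderiv b + smult p (pderiv b * b)"
      by (simp add: distrib_left mult.commute)
    moreover have "coeff (monom a 1 * pderiv b) j = a * of_nat j * coeff b j"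
      by (cases j) (simp_all add: coeff_monom_mult coeff_pderiv)
    ultimately have "a * of_nat j * coeff b j + p * coeff (pderiv b * b) j =
        of_nat m * a * coeff b j + (if j = 2 * m - 1 then p * \<gamma> else 0)"
      using cong_monom_imp_coeff[OF key that] by auto
    then show ?thesis by (simp add: algebra_simps)
  qed
  have prod: "monom 1 (2 * k + 1) dvd pderiv b * b" if "monom 1 (Suc k) dvd b" for k
    using mult_dvd_mono[OF monom_dvd_pderiv[OF that] that] by (simp add: mult_monom mult_2)
  have low: "j \<le> m \<Longrightarrow> monom 1 j dvd b" for j
  proof (induction j)
    case (Suc j)
    have IH: "coeff b i = 0" if "i < j" for i
      using Suc that by (simp add: monom_1_dvd_iff')
    have "coeff b j = 0"
    proof (cases "j < 2")
      case True
      then show ?thesis using b(1) by (simp add: monom_1_dvd_iff')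
    next
      case False
      \<comment> \<open>If t^j divides b, then b (db/dt) has order at least 2j - 1, which exceeds j
        exactly when j \<ge> 2; degrees 0 and 1 were settled by the hypothesis on b.\<close>
      define k where "k = j - 1"
      have j: "j = Suc k" "0 < k" using False by (simp_all add: k_def)
      have "monom 1 (2 * k + 1) dvd pderiv b * b" using Suc by (intro prod) (simp add: j)
      then have "coeff (pderiv b * b) j = 0" using j by (simp add: monom_1_dvd_iff')
      then have "a * (of_nat j - of_nat m) * coeff b j = 0" using coeff[of j] Suc.prems by simp
      moreover have "of_nat j \<noteq> (of_nat m :: complex)" using Suc.prems by (simp only: of_nat_eq_iff)
      ultimately show ?thesis using a by simp
    qed
    then show ?case using IH by (auto simp: monom_1_dvd_iff' less_Suc_eq)
  qed simp
  have "monom 1 (2 * (m - 1) + 1) dvd pderiv b * b"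
    using low[of m] m by (intro prod) simp
  then have high: "coeff (pderiv b * b) j = 0" if "j < 2 * m - 1" for j
    using that m by (auto simp: monom_1_dvd_iff' elim!: allE[of _ j])
  have zero: "coeff b j = 0" if "j \<noteq> m" "j \<noteq> 2 * m - 1" for j
  proof (cases "j < 2 * m")
    case True
    have "a * (of_nat j - of_nat m) * coeff b j = 0" using coeff[OF True] high[of j] True that by simp
    moreover have "of_nat j \<noteq> (of_nat m :: complex)" using that by (simp only: of_nat_eq_iff not_False_eq_True)
    ultimately show ?thesis using a by simp
  qed (use b(2) in simp)
  define s where "s = coeff b m"
  define q where "q = coeff b (2 * m - 1)"
  have eq: "b = monom s m + monom q (2 * m - 1)"
  proof (rule poly_eqI)
    fix j
    show "coeff b j = coeff (monom s m + monom q (2 * m - 1)) j"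
      using zero[of j] m by (cases "j = m"; cases "j = 2 * m - 1") (auto simp: s_def q_def)
  qed
  have "coeff (pderiv b * b) (2 * m - 1) = of_nat m * s\<^sup>2"
    unfolding eq pderiv_add pderiv_monom distrib_left distrib_right mult_monom coeff_add coeff_monom
    using m by (simp add: power2_eq_square) arith
  then have "a * (of_nat (2 * m - 1) - of_nat m) * q = p * (\<gamma> - of_nat m * s\<^sup>2)"
    using coeff[of "2 * m - 1"] m by (simp add: q_def right_diff_distrib)
  moreover have "of_nat (2 * m - 1) \<noteq> (of_nat m :: complex)"
    using m by (simp only: of_nat_eq_iff)
  ultimately have "q = 0 \<or> \<gamma> \<noteq> of_nat m * s\<^sup>2" using a by auto
  with eq that show thesis by blast
qed

text \<open>The perturbation w of A t has order at least m, so w^2 vanishes modulo t^(2m) and the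
  m-th power is linear in w. Its factor t^(m-1) lifts the s' term to degree 2m - 1 and pushes the q'
  term out of range; the power 2m - 1 keeps only its leading term.\<close>

lemma pcompose_two_monoms:
  fixes s q s' q' A B :: complex
  assumes m: "2 \<le> m"
  shows "[pcompose (monom s m + monom q (2 * m - 1)) (monom A 1 + smult B (monom s' m + monom q' (2 * m - 1))) =
     monom (s * A ^ m) m + monom (q * A ^ (2 * m - 1) + s * of_nat m * A ^ (m - 1) * B * s') (2 * m - 1)]
     (mod monom 1 (2 * m))"
proof -
  define w where "w = smult B (monom s' m + monom q' (2 * m - 1))"
  define g where "g = monom A 1 + w"
  let ?r = "of_nat m * A ^ (m - 1) * B * s'"
  have wm: "monom 1 m dvd w" using m by (simp add: w_def dvd_smult monom_1_dvd_iff')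
  have w2: "monom 1 2 dvd w" using m by (simp add: w_def dvd_smult monom_1_dvd_iff')
  have "[g ^ m = monom A 1 ^ m + of_nat m * monom A 1 ^ (m - 1) * w] (mod monom 1 (2 * m))"
  proof -
    have "w ^ 2 dvd g ^ m - (monom A 1 ^ m + of_nat m * monom A 1 ^ (m - 1) * w)"
      using binomial_first_order[of w "monom A 1" "m - 1"] m by (simp add: g_def)
    moreover have "monom 1 (2 * m) dvd w ^ 2"
      using dvd_power_same[OF wm, of 2] by (simp add: monom_power mult.commute)
    ultimately show ?thesis unfolding cong_iff_dvd_diff by (rule dvd_trans[rotated])
  qed
  also have "of_nat m * monom A 1 ^ (m - 1) * w = monom ?r (2 * m - 1) + monom (of_nat m * A ^ (m - 1) * B * q') (m - 1 + (2 * m - 1))"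
  proof -
    have "of_nat m = monom (of_nat m :: complex) 0" by (simp add: monom_0 of_nat_poly)
    moreover have "m + (m - 1) = 2 * m - 1" using m by simp
    ultimately show ?thesis
      by (simp add: w_def monom_power mult_monom smult_add_right smult_monom distrib_left mult_ac add_ac)
  qed
  also have "[monom A 1 ^ m + (monom ?r (2 * m - 1) + monom (of_nat m * A ^ (m - 1) * B * q') (m - 1 + (2 * m - 1)))
      = monom A 1 ^ m + (monom ?r (2 * m - 1) + 0)] (mod monom 1 (2 * m))"
    using m by (intro cong_add cong_refl) (simp add: cong_monom_iff)
  finally have gm: "[g ^ m = monom (A ^ m) m + monom ?r (2 * m - 1)] (mod monom 1 (2 * m))"
    by (simp add: monom_power)
  have "[g ^ (2 * m - 1) = monom (A ^ (2 * m - 1)) (2 * m - 1)] (mod monom 1 (2 * m))"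
    using cong_monom_power[OF w2, of A "2 * m - 1"] m by (simp add: g_def)
  with gm have "[smult s (g ^ m) + smult q (g ^ (2 * m - 1)) =
      smult s (monom (A ^ m) m + monom ?r (2 * m - 1)) + smult q (monom (A ^ (2 * m - 1)) (2 * m - 1))] (mod monom 1 (2 * m))"
    by (intro cong_add cong_smult)
  moreover have "smult s (monom (A ^ m) m + monom ?r (2 * m - 1)) + smult q (monom (A ^ (2 * m - 1)) (2 * m - 1)) =
     monom (s * A ^ m) m + monom (q * A ^ (2 * m - 1) + s * of_nat m * A ^ (m - 1) * B * s') (2 * m - 1)"
    by (simp add: smult_add_right smult_monom add_monom[symmetric] mult_ac add_ac)
  ultimately show ?thesis
    by (simp add: pcompose_add pcompose_monom g_def w_def)
qed

text \<open>Degree m gives s A^m = C s', and A^(2m) = C^2 makes C equal to A^m or its negative. In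
  degree 2m - 1, if m s'^2 = 1, both terms with B agree after multiplication by A, leaving A C q' =
  0.\<close>

lemma isomorphism_two_monoms:
  assumes m: "2 \<le> m" and iso: "isomorphic_algebras (F2 (2 * m) \<beta> 1) (F2 (2 * m) \<beta>' 1)"
    and b: "beta_poly (2 * m) \<beta> = monom s m"
    and b': "beta_poly (2 * m) \<beta>' = monom s' m + monom q' (2 * m - 1)"
  shows "(s = s' \<or> s = - s') \<and> (q' = 0 \<or> of_nat m * s'\<^sup>2 \<noteq> 1)"
proof -
  have n3: "3 \<le> 2 * m" using m by simp
  obtain A B C where A: "A \<noteq> 0" and AC: "1 * A ^ (2 * m) = C\<^sup>2 * 1"
    and key: "[pcompose (monom s m) (monom A 1 + smult B (monom s' m + monom q' (2 * m - 1))) =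
      smult C (monom s' m + monom q' (2 * m - 1)) + monom (B * C * 1 / A) (2 * m - 1)] (mod monom 1 (2 * m))"
    using isomorphism_F2[OF n3 _ iso] unfolding b b' by (metis zero_neq_one)
  have "[monom (s * A ^ m) m + monom (s * of_nat m * A ^ (m - 1) * B * s') (2 * m - 1) =
      smult C (monom s' m + monom q' (2 * m - 1)) + monom (B * C * 1 / A) (2 * m - 1)] (mod monom 1 (2 * m))"
    using cong_trans[OF cong_sym[OF pcompose_two_monoms[OF m, of s 0 A B s' q']]] key by simp
  note coeff = cong_monom_imp_coeff[OF this]
  have nm: "2 * m - Suc 0 \<noteq> m" using m by arith
  have mid: "s * A ^ m = C * s'" using coeff[of m] m nm by simp
  have top: "s * of_nat m * A ^ (m - 1) * B * s' = C * q' + B * C / A"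
    using coeff[of "2 * m - 1"] m nm by simp
  have C: "C \<noteq> 0" using A AC by auto
  have "(A ^ m)\<^sup>2 = C\<^sup>2" using AC by (simp add: power_mult[symmetric] mult.commute)
  then have "C = A ^ m \<or> C = - (A ^ m)" using power2_eq_iff by metis
  then have "(s - s') * A ^ m = 0 \<or> (s + s') * A ^ m = 0" using mid by (auto simp: algebra_simps)
  then have "s = s' \<or> s = - s'" using A by (simp add: eq_neg_iff_add_eq_0)
  moreover have "q' = 0" if "of_nat m * s'\<^sup>2 = 1"
  proof -
    have "A ^ m = A * A ^ (m - 1)" using m by (simp add: power_Suc[symmetric] del: power_Suc)
    then have "A * (s * of_nat m * A ^ (m - 1) * B * s') = (s * A ^ m) * of_nat m * B * s'"
      by (simp add: mult_ac)
    also have "\<dots> = C * B * (of_nat m * s'\<^sup>2)" unfolding mid by (simp add: power2_eq_square mult_ac)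
    finally have "C * B = A * (C * q' + B * C / A)" unfolding top that by simp
    then show ?thesis using A C by (simp add: field_simps)
  qed
  ultimately show ?thesis by blast
qed

section \<open>The classification for even n\<close>

lemma beta_poly_F2_1:
  assumes "2 \<le> m"
  shows "beta_poly (2 * m) (\<lambda>k. if k = (2 * m + 2) div 2 then s else 0) = monom s m"
  using assms by (intro poly_eqI) (auto simp: coeff_beta_poly)

lemma beta_poly_F2_2:
  assumes "2 \<le> m"
  shows "beta_poly (2 * m) (\<lambda>k. if k = (2 * m + 2) div 2 then s else if k = 2 * m then 1 else 0) =
    monom s m + monom 1 (2 * m - 1)"
  using assms by (intro poly_eqI) (auto simp: coeff_beta_poly)

theorem theorem3p11:
  fixes n :: nat and \<beta> :: "nat \<Rightarrow> complex" and \<gamma> :: complex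
    and L :: "(nat \<Rightarrow> complex) algebra"
  assumes "3 \<le> n" and "even n"
    and "L = F2 n \<beta> \<gamma>" and "\<gamma> \<noteq> 0"
    and "leibniz_algebra L" and "filiform L" and "non_characteristically_nilpotent L"
  shows "((\<exists>b. isomorphic_algebras L (F2_1 n b)) \<or> isomorphic_algebras L (F2_2 n))
       \<and> (\<forall>b. \<not> isomorphic_algebras (F2_1 n b) (F2_2 n))
       \<and> (\<forall>b b'. b' \<noteq> b \<and> b' \<noteq> - b \<longrightarrow> \<not> isomorphic_algebras (F2_1 n b) (F2_1 n b'))"
proof -
  obtain m where n: "n = 2 * m" using \<open>even n\<close> by (rule evenE)
  have m: "2 \<le> m" using \<open>3 \<le> n\<close> n by simp
  \<comment> \<open>The first alternative is reached in every case: the normal form of b from the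
    derivation allows the term in t^(n-1) to be removed.\<close>
  have "\<exists>b. isomorphic_algebras L (F2_1 n b)"
  proof -
    obtain d where d: "derivation (F2 n \<beta> \<gamma>) d" "\<not> nilpotent_map (F2 n \<beta> \<gamma>) d"
      using assms(3,7) unfolding non_characteristically_nilpotent_def by blast
    obtain a c p where ac: "of_nat n * a = 2 * c"
      and key: "[pderiv (beta_poly n \<beta>) * (monom a 1 + smult p (beta_poly n \<beta>)) =
        smult c (beta_poly n \<beta>) + monom (p * \<gamma>) (n - 1)] (mod monom 1 n)"
      and nil: "a = 0 \<longrightarrow> nilpotent_map (F2 n \<beta> \<gamma>) d"
      by (rule derivation_F2[OF \<open>3 \<le> n\<close> \<open>\<gamma> \<noteq> 0\<close> d(1)])
    have "a \<noteq> 0" using nil d(2) by blast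
    have "c = of_nat m * a" using ac by (simp add: n)
    have "coeff (beta_poly (2 * m) \<beta>) j = 0" if "2 * m \<le> j" for j
      using that by (simp add: coeff_beta_poly)
    then obtain s q where "beta_poly (2 * m) \<beta> = monom s m + monom q (2 * m - 1)"
      and q: "q = 0 \<or> \<gamma> \<noteq> of_nat m * s\<^sup>2"
      by (rule derivation_beta_poly[OF m \<open>a \<noteq> 0\<close> beta_poly_dvd _ key[unfolded n \<open>c = of_nat m * a\<close>]])
    then have b: "beta_poly n \<beta> = monom s m + monom q (n - 1)" by (simp add: n)
    \<comment> \<open>With A = 1, the choice C = r normalises \<gamma> to 1 and the coefficient s to
      s / r.\<close>
    define r where "r = csqrt \<gamma>"
    have r: "\<gamma> = r\<^sup>2 * 1" "r \<noteq> 0" using \<open>\<gamma> \<noteq> 0\<close> by (simp_all add: r_def)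
    \<comment> \<open>\<open>B\<close> solves the equation of degree n - 1 for a target without a
      term in t^(n-1), namely B (\<gamma> - m s^2) = q r; for q \<noteq> 0 the denominator is
      nonzero by the dichotomy for q.\<close>
    define B where "B = (if q = 0 then 0 else q * r / (\<gamma> - of_nat m * s\<^sup>2))"
    have B: "q + s * of_nat m * B * (s / r) = B * r"
    proof (cases "q = 0")
      case False
      then have "B * (\<gamma> - of_nat m * s\<^sup>2) = q * r" using q by (simp add: B_def)
      then have "B * r * r = q * r + B * of_nat m * s * s"
        by (simp add: r(1) algebra_simps power2_eq_square)
      then show ?thesis using r(2) by (simp add: field_simps)
    qed (simp add: B_def)
    have "isomorphic_algebras (F2 n \<beta> \<gamma>) (F2 n (\<lambda>k. if k = (n + 2) div 2 then s / r else 0) 1)"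
    proof (rule isomorphic_F2_I[OF \<open>3 \<le> n\<close> r(2,1), where B = B])
      have b': "beta_poly n (\<lambda>k. if k = (n + 2) div 2 then s / r else 0) = monom (s / r) m"
        unfolding n by (rule beta_poly_F2_1[OF m])
      have "monom s m + monom (B * r) (n - 1) = smult r (monom (s / r) m) + monom (B * r * 1) (n - 1)"
        using r(2) by (simp add: smult_monom)
      then show "[pcompose (beta_poly n \<beta>)
          (monom 1 1 + smult B (beta_poly n (\<lambda>k. if k = (n + 2) div 2 then s / r else 0))) =
        smult r (beta_poly n (\<lambda>k. if k = (n + 2) div 2 then s / r else 0)) + monom (B * r * 1) (n - 1)]
        (mod monom 1 n)"
        using pcompose_two_monoms[OF m, of s q 1 B "s / r" 0] unfolding b b'
        by (simp only: n power_one mult_1_right B monom_eq_0 add_0_right)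
    qed
    then show ?thesis using assms(3) unfolding F2_1_def by blast
  qed
  moreover have "\<not> isomorphic_algebras (F2_1 n b) (F2_2 n)" for b
  proof
    let ?s = "complex_of_real (sqrt (2 / real n))"
    assume "isomorphic_algebras (F2_1 n b) (F2_2 n)"
    \<comment> \<open>For \<open>F2_2\<close> the coefficient of t^(n-1) is 1 while m (2 / n) = 1,
      the very case in which that coefficient would have to vanish.\<close>
    then have "(1::complex) = 0 \<or> of_nat m * ?s\<^sup>2 \<noteq> 1"
      using isomorphism_two_monoms[OF m _ beta_poly_F2_1[OF m] beta_poly_F2_2[OF m]]
      unfolding F2_1_def F2_2_def n by blast
    moreover have "of_nat m * ?s\<^sup>2 = complex_of_real (real m * (2 / real n))"
      by (simp add: of_real_power[symmetric] del: of_real_power)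
    ultimately show False using m by (simp add: n)
  qed
  moreover have "b' = b \<or> b' = - b" if "isomorphic_algebras (F2_1 n b) (F2_1 n b')" for b b'
  proof -
    \<comment> \<open>The zero monomial brings the target into the two-term shape with q' =
      0.\<close>
    have "beta_poly (2 * m) (\<lambda>k. if k = (2 * m + 2) div 2 then b' else 0) = monom b' m + monom 0 (2 * m - 1)"
      using beta_poly_F2_1[OF m, of b'] by simp
    from isomorphism_two_monoms[OF m that[unfolded F2_1_def n] beta_poly_F2_1[OF m] this]
    show ?thesis by auto
  qed
  ultimately show ?thesis by blast
qed

end
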